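(* Let $G$ be a (finite, simple) graph with vertex set $X$ and let $k\in\mathbb N$. The following are equivalent: (i) the graph $G$ has an orthogonal representation in $\mathbb C^k$; (ii) there exists a quantum $\mathrm{loc}$-colouring of $G$ by a set $A$ with $|A|=k$.
   Context: For vertices $x,y$, $x\sim y$ means that $\{x,y\}$ is an edge. An orthogonal representation of $G$ in $\mathbb C^k$ is a family $(\xi_x)_{x\in X}$ of unit vectors in $\mathbb C^k$ such that $x\sim y\Rightarrow\langle\xi_x,\xi_y\rangle=0$. Notation: $M_A=\mathcal L(\mathbb C^A)$, $\mathcal D_X\subseteq M_X$ is the diagonal algebra, $\mathcal D_{XX}=\mathcal D_X\otimes\mathcal D_X$, $M_{AA}=M_A\otimes M_A$, $(e_x)$ is the canonical basis, $\xi\eta^*$ is the rank one operator $\zeta\mapsto\langle\zeta,\eta\rangle\xi$; the pairing on $M_{AA}$ is $\langle\rho,\omega\rangle=\mathrm{Tr}(\rho\omega^{\mathrm t})$; $\Omega_A=\sum_{a,b\in A}e_ae_b^*\otimes e_ae_b^*$. A CQNS correlation is a channel (completely positive trace preserving map) $\mathcal E:\mathcal D_{XX}\to M_{AA}$ such that, with $\sigma_{x,y}=\mathcal E(e_xe_x^*\otimes e_ye_y^* )$, the partial trace of $\sigma_{x,y}$ over the first (resp. second) tensor factor of $M_A\otimes M_A$ does not depend on $x$ (resp. $y$). It is locally tracial if there exist a unital abelian C*-algebra $\mathcal A$, a trace (tracial state) $\tau$ on $\mathcal A$, and elements $g_{x,a,a'}\in\mathcal A$ such that, for each $x\in X$,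 $(g_{x,a,a'})_{a,a'}\in(M_A\otimes\mathcal A)^+$ and $\sum_ag_{x,a,a}=1$, with $$\mathcal E(e_xe_x^*\otimes e_ye_y^* )=\sum_{a,a',b,b'\in A}\tau(g_{x,a,a'}g_{y,b',b})\,e_ae_{a'}^*\otimes e_be_{b'}^*,\quad x,y\in X.$$ A CQNS correlation $\mathcal E$ is $G$-proper if $x\sim y\Rightarrow\langle\mathcal E(e_xe_x^*\otimes e_ye_y^* ),\Omega_A\rangle=0$. A quantum $\mathrm{loc}$-colouring of $G$ by $A$ is a $G$-proper locally tracial CQNS correlation $\mathcal E:\mathcal D_{XX}\to M_{AA}$. *)

theory Defs
  imports
    Complex_Main
    "HOL-Library.Ramsey"
    "HOL-Library.Nonpos_Ints"
    "HOL-Algebra.Module"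
    "Jordan_Normal_Form.Matrix"
begin

text \<open>
  A finite simple graph is a finite vertex set \<open>V\<close> together with an edge set
  \<open>Es \<subseteq> nsets V 2\<close> of two-element subsets of \<open>V\<close>; adjacency of \<open>x\<close> and \<open>y\<close> is
  \<open>{x, y} \<in> Es\<close>.
\<close>

definition orthogonal_representation ::
    "'x set \<Rightarrow> 'x set set \<Rightarrow> nat \<Rightarrow> ('x \<Rightarrow> complex vec) \<Rightarrow> bool" where
  "orthogonal_representation V Es k \<xi> \<longleftrightarrow>
     (\<forall>x\<in>V. \<xi> x \<in> carrier_vec k \<and> \<xi> x \<bullet>c \<xi> x = 1) \<and>
     (\<forall>x\<in>V. \<forall>y\<in>V. {x, y} \<in> Es \<longrightarrow> \<xi> x \<bullet>c \<xi> y = 0)"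


section \<open>Matrices over finite index sets\<close>

text \<open>
  An operator on \<open>\<complex>\<^sup>I\<close> is its matrix \<open>M i j = \<langle>M e\<^sub>j, e\<^sub>i\<rangle>\<close>, made unique by
  requiring entries outside \<open>I \<times> I\<close> to vanish. Tensor products of operators on \<open>\<complex>\<^sup>I\<close> and
  \<open>\<complex>\<^sup>J\<close> are matrices over \<open>I \<times> J\<close>: thus \<open>M\<^sub>A \<otimes> M\<^sub>A\<close> is
  \<open>mat_alg (A \<times> A)\<close> and \<open>D\<^sub>V \<otimes> D\<^sub>V\<close> is \<open>diag_alg (V \<times> V)\<close>.
\<close>

type_synonym 'i cmat = "'i \<Rightarrow> 'i \<Rightarrow> complex"

definition mat_alg :: "'i set \<Rightarrow> 'i cmat set" where
  "mat_alg I = {M. \<forall>i j. i \<notin> I \<or> j \<notin> I \<longrightarrow> M i j = 0}"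

definition diag_alg :: "'i set \<Rightarrow> 'i cmat set" where
  "diag_alg I = {M \<in> mat_alg I. \<forall>i j. i \<noteq> j \<longrightarrow> M i j = 0}"

text \<open>The rank one operator \<open>e\<^sub>i e\<^sub>j\<^sup>*\<close>.\<close>

definition mat_unit :: "'i \<Rightarrow> 'i \<Rightarrow> 'i cmat" where
  "mat_unit i j = (\<lambda>k l. if k = i \<and> l = j then 1 else 0)"

definition mat_tensor :: "'i cmat \<Rightarrow> 'j cmat \<Rightarrow> ('i \<times> 'j) cmat" where
  "mat_tensor M N = (\<lambda>(i, j) (k, l). M i k * N j l)"

definition mat_mult :: "'i set \<Rightarrow> 'i cmat \<Rightarrow> 'i cmat \<Rightarrow> 'i cmat" where
  "mat_mult I M N = (\<lambda>i j. \<Sum>k\<in>I. M i k * N k j)"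

definition mat_transpose :: "'i cmat \<Rightarrow> 'i cmat" where
  "mat_transpose M = (\<lambda>i j. M j i)"

definition mat_trace :: "'i set \<Rightarrow> 'i cmat \<Rightarrow> complex" where
  "mat_trace I M = (\<Sum>i\<in>I. M i i)"

definition mat_pairing :: "'i set \<Rightarrow> 'i cmat \<Rightarrow> 'i cmat \<Rightarrow> complex" where
  "mat_pairing I \<rho> \<omega> = mat_trace I (mat_mult I \<rho> (mat_transpose \<omega>))"

definition Omega :: "'a set \<Rightarrow> ('a \<times> 'a) cmat" where
  "Omega A = (\<lambda>i j. \<Sum>a\<in>A. \<Sum>b\<in>A. mat_tensor (mat_unit a b) (mat_unit a b) i j)"

definition partial_trace1 :: "'a set \<Rightarrow> ('a \<times> 'b) cmat \<Rightarrow> 'b cmat" where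
  "partial_trace1 A \<rho> = (\<lambda>b b'. \<Sum>a\<in>A. \<rho> (a, b) (a, b'))"

definition partial_trace2 :: "'b set \<Rightarrow> ('a \<times> 'b) cmat \<Rightarrow> 'a cmat" where
  "partial_trace2 B \<rho> = (\<lambda>a a'. \<Sum>b\<in>B. \<rho> (a, b) (a', b))"

text \<open>Positivity of an operator on \<open>\<complex>\<^sup>I\<close>: \<open>\<langle>M v, v\<rangle> \<ge> 0\<close> for all \<open>v\<close>.\<close>

definition mat_pos :: "'i set \<Rightarrow> 'i cmat \<Rightarrow> bool" where
  "mat_pos I M \<longleftrightarrow>
     (\<forall>v :: 'i \<Rightarrow> complex. (\<Sum>i\<in>I. \<Sum>j\<in>I. M i j * v j * cnj (v i)) \<in> \<real>\<^sub>\<ge>\<^sub>0)"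


section \<open>Quantum channels\<close>

text \<open>
  The maps below have as domain a linear space \<open>D\<close> of matrices over \<open>I\<close>; their values outside
  \<open>D\<close> are irrelevant.
\<close>

definition mat_linear_on :: "'i cmat set \<Rightarrow> ('i cmat \<Rightarrow> 'j cmat) \<Rightarrow> bool" where
  "mat_linear_on D \<E> \<longleftrightarrow>
     (\<forall>S\<in>D. \<forall>T\<in>D. \<E> (\<lambda>i j. S i j + T i j) = (\<lambda>i j. \<E> S i j + \<E> T i j)) \<and>
     (\<forall>c. \<forall>S\<in>D. \<E> (\<lambda>i j. c * S i j) = (\<lambda>i j. c * \<E> S i j))"

text \<open>
  The element of \<open>M\<^sub>n \<otimes> M\<^sub>I\<close> whose \<open>(p, q)\<close> block is \<open>T p q\<close>.
\<close>

definition block_mat :: "(nat \<Rightarrow> nat \<Rightarrow> 'i cmat) \<Rightarrow> (nat \<times> 'i) cmat" where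
  "block_mat T = (\<lambda>(p, i) (q, j). T p q i j)"

definition completely_positive ::
    "'i set \<Rightarrow> 'i cmat set \<Rightarrow> 'j set \<Rightarrow> ('i cmat \<Rightarrow> 'j cmat) \<Rightarrow> bool" where
  "completely_positive I D J \<E> \<longleftrightarrow>
     (\<forall>n. \<forall>T. (\<forall>p<n. \<forall>q<n. T p q \<in> D) \<longrightarrow>
        mat_pos ({..<n} \<times> I) (block_mat T) \<longrightarrow>
        mat_pos ({..<n} \<times> J) (block_mat (\<lambda>p q. \<E> (T p q))))"

definition quantum_channel ::
    "'i set \<Rightarrow> 'i cmat set \<Rightarrow> 'j set \<Rightarrow> ('i cmat \<Rightarrow> 'j cmat) \<Rightarrow> bool" where
  "quantum_channel I D J \<E> \<longleftrightarrow>
     (\<forall>S\<in>D. \<E> S \<in> mat_alg J) \<and>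
     mat_linear_on D \<E> \<and>
     completely_positive I D J \<E> \<and>
     (\<forall>S\<in>D. mat_trace J (\<E> S) = mat_trace I S)"


section \<open>Unital abelian C*-algebras\<close>

definition complex_ring :: "complex ring" where
  "complex_ring = \<lparr>carrier = UNIV, mult = (*), one = 1, zero = 0, add = (+)\<rparr>"

record 'c cstar = "(complex, 'c) module" +
  cstar_adj :: "'c \<Rightarrow> 'c"
  cstar_norm :: "'c \<Rightarrow> real"

text \<open>
  The locale \<open>Module.algebra\<close> describes commutative unital algebras.
\<close>

locale abelian_cstar_algebra =
  Module.algebra complex_ring \<A>
  for \<A> :: "'c cstar" (structure) +
  assumes adj_closed: "x \<in> carrier \<A> \<Longrightarrow> cstar_adj \<A> x \<in> carrier \<A>"
    and adj_adj: "x \<in> carrier \<A> \<Longrightarrow> cstar_adj \<A> (cstar_adj \<A> x) = x"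
    and adj_add: "\<lbrakk>x \<in> carrier \<A>; y \<in> carrier \<A>\<rbrakk> \<Longrightarrow>
      cstar_adj \<A> (x \<oplus> y) = cstar_adj \<A> x \<oplus> cstar_adj \<A> y"
    and adj_smult: "x \<in> carrier \<A> \<Longrightarrow>
      cstar_adj \<A> (c \<odot> x) = cnj c \<odot> cstar_adj \<A> x"
    and adj_mult: "\<lbrakk>x \<in> carrier \<A>; y \<in> carrier \<A>\<rbrakk> \<Longrightarrow>
      cstar_adj \<A> (x \<otimes> y) = cstar_adj \<A> y \<otimes> cstar_adj \<A> x"
    and norm_nonneg: "x \<in> carrier \<A> \<Longrightarrow> 0 \<le> cstar_norm \<A> x"
    and norm_eq_0: "x \<in> carrier \<A> \<Longrightarrow> cstar_norm \<A> x = 0 \<longleftrightarrow> x = \<zero>"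
    and norm_add: "\<lbrakk>x \<in> carrier \<A>; y \<in> carrier \<A>\<rbrakk> \<Longrightarrow>
      cstar_norm \<A> (x \<oplus> y) \<le> cstar_norm \<A> x + cstar_norm \<A> y"
    and norm_smult: "x \<in> carrier \<A> \<Longrightarrow>
      cstar_norm \<A> (c \<odot> x) = cmod c * cstar_norm \<A> x"
    and norm_mult: "\<lbrakk>x \<in> carrier \<A>; y \<in> carrier \<A>\<rbrakk> \<Longrightarrow>
      cstar_norm \<A> (x \<otimes> y) \<le> cstar_norm \<A> x * cstar_norm \<A> y"
    and cstar_identity: "x \<in> carrier \<A> \<Longrightarrow>
      cstar_norm \<A> (cstar_adj \<A> x \<otimes> x) = (cstar_norm \<A> x)\<^sup>2"
    and complete:
      "\<lbrakk>range s \<subseteq> carrier \<A>;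
        \<And>e. e > 0 \<Longrightarrow> \<exists>N. \<forall>m\<ge>N. \<forall>n\<ge>N. cstar_norm \<A> (s m \<ominus> s n) < e\<rbrakk> \<Longrightarrow>
      \<exists>x\<in>carrier \<A>. (\<lambda>n. cstar_norm \<A> (s n \<ominus> x)) \<longlonglongrightarrow> 0"

definition tracial_state :: "'c cstar \<Rightarrow> ('c \<Rightarrow> complex) \<Rightarrow> bool" where
  "tracial_state \<A> \<tau> \<longleftrightarrow>
     (\<forall>x\<in>carrier \<A>. \<forall>y\<in>carrier \<A>. \<tau> (x \<oplus>\<^bsub>\<A>\<^esub> y) = \<tau> x + \<tau> y) \<and>
     (\<forall>c. \<forall>x\<in>carrier \<A>. \<tau> (c \<odot>\<^bsub>\<A>\<^esub> x) = c * \<tau> x) \<and>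
     (\<forall>x\<in>carrier \<A>. \<tau> (cstar_adj \<A> x \<otimes>\<^bsub>\<A>\<^esub> x) \<in> \<real>\<^sub>\<ge>\<^sub>0) \<and>
     \<tau> \<one>\<^bsub>\<A>\<^esub> = 1 \<and>
     (\<forall>x\<in>carrier \<A>. \<forall>y\<in>carrier \<A>. \<tau> (x \<otimes>\<^bsub>\<A>\<^esub> y) = \<tau> (y \<otimes>\<^bsub>\<A>\<^esub> x))"

text \<open>
  The positive cone of the C*-algebra \<open>M\<^sub>A \<otimes> \<A>\<close>, that is, of the \<open>A \<times> A\<close> matrices
  with entries in \<open>\<A>\<close>: the elements of the form \<open>h\<^sup>* h\<close>, whose entry at \<open>(a, a')\<close> is
  the sum over \<open>b\<close> of \<open>(h b a)\<^sup>* (h b a')\<close>.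
\<close>

definition cstar_mat_pos :: "'c cstar \<Rightarrow> 'a set \<Rightarrow> ('a \<Rightarrow> 'a \<Rightarrow> 'c) \<Rightarrow> bool" where
  "cstar_mat_pos \<A> A g \<longleftrightarrow>
     (\<exists>h. (\<forall>b\<in>A. \<forall>a\<in>A. h b a \<in> carrier \<A>) \<and>
          (\<forall>a\<in>A. \<forall>a'\<in>A.
             g a a' = finsum \<A> (\<lambda>b. cstar_adj \<A> (h b a) \<otimes>\<^bsub>\<A>\<^esub> h b a') A))"


section \<open>CQNS correlations and quantum loc-colourings\<close>

definition corr_state ::
    "(('x \<times> 'x) cmat \<Rightarrow> ('a \<times> 'a) cmat) \<Rightarrow> 'x \<Rightarrow> 'x \<Rightarrow> ('a \<times> 'a) cmat" where
  "corr_state \<E> x y = \<E> (mat_tensor (mat_unit x x) (mat_unit y y))"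

definition CQNS_correlation ::
    "'x set \<Rightarrow> 'a set \<Rightarrow> (('x \<times> 'x) cmat \<Rightarrow> ('a \<times> 'a) cmat) \<Rightarrow> bool" where
  "CQNS_correlation V A \<E> \<longleftrightarrow>
     quantum_channel (V \<times> V) (diag_alg (V \<times> V)) (A \<times> A) \<E> \<and>
     (\<forall>x\<in>V. \<forall>x'\<in>V. \<forall>y\<in>V.
        partial_trace1 A (corr_state \<E> x y) = partial_trace1 A (corr_state \<E> x' y)) \<and>
     (\<forall>x\<in>V. \<forall>y\<in>V. \<forall>y'\<in>V.
        partial_trace2 A (corr_state \<E> x y) = partial_trace2 A (corr_state \<E> x y'))"

text \<open>
  HOL cannot quantify over types inside a formula, so the C*-algebra ranges over all unital
  abelian C*-algebras whose carrier is a subset of the type \<open>'c\<close>. A nonzero unital complex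
  algebra contains a copy of \<open>\<complex>\<close>, and only nonzero ones carry a state, so \<open>'c\<close> is an
  adequate universe only if \<open>\<complex>\<close> injects into it; this is the hypothesis on \<open>'c\<close> in the
  theorem, which is otherwise polymorphic in \<open>'c\<close>. In the same way the colour sets \<open>A\<close> of
  the theorem are the finite subsets of an arbitrary infinite type.
\<close>

definition locally_tracial ::
    "'c itself \<Rightarrow> 'x set \<Rightarrow> 'a set \<Rightarrow> (('x \<times> 'x) cmat \<Rightarrow> ('a \<times> 'a) cmat) \<Rightarrow> bool" where
  "locally_tracial U V A \<E> \<longleftrightarrow>
     (\<exists>(\<A> :: 'c cstar) \<tau> g.
        abelian_cstar_algebra \<A> \<and>
        tracial_state \<A> \<tau> \<and>
        (\<forall>x\<in>V. \<forall>a\<in>A. \<forall>a'\<in>A. g x a a' \<in> carrier \<A>) \<and>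
        (\<forall>x\<in>V. cstar_mat_pos \<A> A (g x)) \<and>
        (\<forall>x\<in>V. finsum \<A> (\<lambda>a. g x a a) A = \<one>\<^bsub>\<A>\<^esub>) \<and>
        (\<forall>x\<in>V. \<forall>y\<in>V. corr_state \<E> x y =
           (\<lambda>i j. \<Sum>a\<in>A. \<Sum>a'\<in>A. \<Sum>b\<in>A. \<Sum>b'\<in>A.
              \<tau> (g x a a' \<otimes>\<^bsub>\<A>\<^esub> g y b' b) *
              mat_tensor (mat_unit a a') (mat_unit b b') i j)))"

definition graph_proper ::
    "'x set \<Rightarrow> 'x set set \<Rightarrow> 'a set \<Rightarrow> (('x \<times> 'x) cmat \<Rightarrow> ('a \<times> 'a) cmat) \<Rightarrow> bool" where
  "graph_proper V Es A \<E> \<longleftrightarrow>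
     (\<forall>x\<in>V. \<forall>y\<in>V. {x, y} \<in> Es \<longrightarrow>
        mat_pairing (A \<times> A) (corr_state \<E> x y) (Omega A) = 0)"

definition quantum_loc_colouring ::
    "'c itself \<Rightarrow> 'x set \<Rightarrow> 'x set set \<Rightarrow> 'a set \<Rightarrow>
     (('x \<times> 'x) cmat \<Rightarrow> ('a \<times> 'a) cmat) \<Rightarrow> bool" where
  "quantum_loc_colouring U V Es A \<E> \<longleftrightarrow>
     CQNS_correlation V A \<E> \<and> locally_tracial U V A \<E> \<and> graph_proper V Es A \<E>"

end

theory Submission
  imports Defs
begin

text \<open>
  An orthogonal representation gives the rank one projections \<open>g\<^sub>x\<close> over the algebra
  \<open>\<complex>\<close>. Conversely, write \<open>g\<^sub>x = h\<^sub>x\<^sup>* h\<^sub>x\<close>; by commutativity properness says that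
  \<open>\<tau>(n\<^sup>* n) = 0\<close> for all the elements \<open>n = \<Sum>\<^sub>a (h\<^sub>x b a)\<^sup>* (h\<^sub>y c a)\<close> with \<open>x \<sim> y\<close>. A character of the
  algebra annihilating these \<open>n\<close> would turn the rows of \<open>h\<^sub>x\<close> into vectors of \<open>\<complex>\<^sup>k\<close>, orthogonal
  for adjacent vertices and not all zero. Gelfand theory is avoided: for a self-adjoint
  contraction \<open>a\<close>, a state \<open>\<phi>\<close> is a convex combination of the normalised functionals
  \<open>\<phi>((1 + a) \<cdot>)\<close> and \<open>\<phi>((1 - a) \<cdot>)\<close>, and this splitting increases \<open>\<Sum>\<^sub>b \<phi>(b)\<^sup>2\<close> for one of the
  two by at least the squared variance of \<open>a\<close>. States that nearly maximise the sum have
  small variances, hence are nearly multiplicative, and the limit of their values on the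
  finitely many entries of the \<open>h\<^sub>x\<close> serves as the character.
\<close>

section \<open>Positive functionals\<close>

text \<open>No normalisation is imposed, so that compressed and weighted functionals, which need not
  be states, stay in the class.\<close>

definition positive_functional :: "'c cstar \<Rightarrow> ('c \<Rightarrow> complex) \<Rightarrow> bool" where
  "positive_functional \<A> \<phi> \<longleftrightarrow>
     (\<forall>x\<in>carrier \<A>. \<forall>y\<in>carrier \<A>. \<phi> (x \<oplus>\<^bsub>\<A>\<^esub> y) = \<phi> x + \<phi> y) \<and>
     (\<forall>c. \<forall>x\<in>carrier \<A>. \<phi> (c \<odot>\<^bsub>\<A>\<^esub> x) = c * \<phi> x) \<and>
     (\<forall>x\<in>carrier \<A>. \<phi> (cstar_adj \<A> x \<otimes>\<^bsub>\<A>\<^esub> x) \<in> \<real>\<^sub>\<ge>\<^sub>0)"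

text \<open>The condition on \<open>N\<close> carries the orthogonality relations of a proper
  colouring; it has to survive every change of state.\<close>

definition state_killing :: "'c cstar \<Rightarrow> 'c set \<Rightarrow> ('c \<Rightarrow> complex) \<Rightarrow> bool" where
  "state_killing \<A> N \<phi> \<longleftrightarrow> positive_functional \<A> \<phi> \<and> \<phi> \<one>\<^bsub>\<A>\<^esub> = 1 \<and>
     (\<forall>n\<in>N. \<phi> (cstar_adj \<A> n \<otimes>\<^bsub>\<A>\<^esub> n) = 0)"

text \<open>This encodes \<open>a* a \<le> 1\<close> by testing against positive functionals instead
  of by the norm or the spectrum. Since all of them are tested, the bound can be applied to
  compressions of a given functional.\<close>

definition contractive :: "'c cstar \<Rightarrow> 'c \<Rightarrow> bool" where
  "contractive \<A> a \<longleftrightarrow> a \<in> carrier \<A> \<and>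
     (\<forall>\<phi>. positive_functional \<A> \<phi> \<longrightarrow> Re (\<phi> (cstar_adj \<A> a \<otimes>\<^bsub>\<A>\<^esub> a)) \<le> Re (\<phi> \<one>\<^bsub>\<A>\<^esub>))"

lemma complex_ring_simps [simp]:
  "carrier complex_ring = UNIV"
  "x \<otimes>\<^bsub>complex_ring\<^esub> y = x * y"
  "x \<oplus>\<^bsub>complex_ring\<^esub> y = x + y"
  "\<one>\<^bsub>complex_ring\<^esub> = 1"
  "\<zero>\<^bsub>complex_ring\<^esub> = 0"
  by (simp_all add: complex_ring_def)

text \<open>The two quotients are the values of the two halves of a split functional. With weights
  \<open>(1 + m) / 2\<close> and \<open>(1 - m) / 2\<close> their mean is \<open>\<beta>\<close>,
  and the last summand is the variance of this two-point distribution.\<close>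

lemma split_squares_identity:
  fixes m \<beta> \<gamma> :: real
  assumes "\<bar>m\<bar> < 1"
  shows "(1 + m) / 2 * ((\<beta> + \<gamma>) / (1 + m))\<^sup>2 + (1 - m) / 2 * ((\<beta> - \<gamma>) / (1 - m))\<^sup>2
     = \<beta>\<^sup>2 + (\<gamma> - m * \<beta>)\<^sup>2 / (1 - m\<^sup>2)"
proof -
  have m: "1 + m \<noteq> 0" "1 - m \<noteq> 0" using assms by auto
  have eq: "1 - m\<^sup>2 = (1 + m) * (1 - m)" by (simp add: power2_eq_square algebra_simps)
  show ?thesis
    unfolding eq using m by (simp add: divide_simps power2_eq_square) (simp add: algebra_simps)
qed

context abelian_cstar_algebra
begin

lemma adj_one [simp]: "cstar_adj \<A> \<one> = \<one>"
proof -
  have "cstar_adj \<A> (cstar_adj \<A> \<one> \<otimes> \<one>) = cstar_adj \<A> \<one> \<otimes> \<one>"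
    by (metis adj_adj adj_closed adj_mult one_closed r_one)
  then show ?thesis by (simp add: adj_adj adj_closed)
qed

lemma smult_in [simp, intro]: "x \<in> carrier \<A> \<Longrightarrow> c \<odot> x \<in> carrier \<A>"
  using smult_closed by simp

lemma mult_smult_left: "\<lbrakk>x \<in> carrier \<A>; y \<in> carrier \<A>\<rbrakk> \<Longrightarrow> (c \<odot> x) \<otimes> y = c \<odot> (x \<otimes> y)"
  by (simp add: smult_assoc2)

lemma mult_smult_right: "\<lbrakk>x \<in> carrier \<A>; y \<in> carrier \<A>\<rbrakk> \<Longrightarrow> x \<otimes> (c \<odot> y) = c \<odot> (x \<otimes> y)"
  by (metis m_comm smult_in mult_smult_left)

lemma adj_finsum:
  assumes "finite I" "f \<in> I \<rightarrow> carrier \<A>"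
  shows "cstar_adj \<A> (finsum \<A> f I) = finsum \<A> (\<lambda>i. cstar_adj \<A> (f i)) I"
  using assms
proof (induction I rule: finite_induct)
  case empty
  \<comment> \<open>The adjoint of zero comes from conjugate homogeneity, with zero written as a
    zero multiple of the unit.\<close>
  have "cstar_adj \<A> (0 \<odot> \<one>) = 0 \<odot> \<one>"
    by (subst adj_smult) auto
  then show ?case using smult_l_null[of \<one>] by simp
next
  case (insert i I)
  then have "f i \<in> carrier \<A>" "f \<in> I \<rightarrow> carrier \<A>" by auto
  with insert show ?case
    by (simp add: adj_add Pi_def adj_closed)
qed

end

locale positive_functional_on = abelian_cstar_algebra +
  fixes \<phi> :: "'a \<Rightarrow> complex"
  assumes positive: "positive_functional \<A> \<phi>"
begin

lemma fun_add: "\<lbrakk>x \<in> carrier \<A>; y \<in> carrier \<A>\<rbrakk> \<Longrightarrow> \<phi> (x \<oplus> y) = \<phi> x + \<phi> y"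
  and fun_smult: "x \<in> carrier \<A> \<Longrightarrow> \<phi> (c \<odot> x) = c * \<phi> x"
  and fun_square: "x \<in> carrier \<A> \<Longrightarrow> \<phi> (cstar_adj \<A> x \<otimes> x) \<in> \<real>\<^sub>\<ge>\<^sub>0"
  using positive by (auto simp: positive_functional_def)

lemma fun_zero [simp]: "\<phi> \<zero> = 0"
  using fun_smult[of \<one> 0] smult_l_null[of \<one>] by simp

lemma fun_finsum:
  assumes "finite I" "f \<in> I \<rightarrow> carrier \<A>"
  shows "\<phi> (finsum \<A> f I) = (\<Sum>i\<in>I. \<phi> (f i))"
  using assms
proof (induction I rule: finite_induct)
  case (insert i I)
  then have "f i \<in> carrier \<A>" "f \<in> I \<rightarrow> carrier \<A>" by auto
  with insert show ?case by (simp add: fun_add)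
qed simp

lemma sesquilinear_expand:
  assumes "x \<in> carrier \<A>" "y \<in> carrier \<A>" "u \<in> carrier \<A>" "v \<in> carrier \<A>"
  shows "\<phi> (cstar_adj \<A> (x \<oplus> c \<odot> y) \<otimes> (u \<oplus> d \<odot> v)) =
    \<phi> (cstar_adj \<A> x \<otimes> u) + d * \<phi> (cstar_adj \<A> x \<otimes> v) +
    cnj c * \<phi> (cstar_adj \<A> y \<otimes> u) + cnj c * d * \<phi> (cstar_adj \<A> y \<otimes> v)"
  using assms
  by (simp add: adj_add adj_smult adj_closed l_distr r_distr mult_smult_left mult_smult_right
      fun_add fun_smult distrib_left)

lemma hermitian:
  assumes "x \<in> carrier \<A>" "y \<in> carrier \<A>"
  shows "\<phi> (cstar_adj \<A> y \<otimes> x) = cnj (\<phi> (cstar_adj \<A> x \<otimes> y))"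
proof -
  have q: "Im (\<phi> (cstar_adj \<A> z \<otimes> z)) = 0" if "z \<in> carrier \<A>" for z
    using fun_square[OF that] by (simp add: complex_nonneg_Reals_iff)
  have "Im (\<phi> (cstar_adj \<A> (x \<oplus> c \<odot> y) \<otimes> (x \<oplus> c \<odot> y))) = 0" for c
    using assms by (intro q) auto
  \<comment> \<open>Polarisation: \<open>c = 1\<close> compares the imaginary parts of the two mixed
    terms, \<open>c = \<i>\<close> their real parts.\<close>
  from this[of 1] this[of \<i>] show ?thesis
    using assms by (simp add: sesquilinear_expand q complex_eq_iff)
qed

lemma fun_adj: "x \<in> carrier \<A> \<Longrightarrow> \<phi> (cstar_adj \<A> x) = cnj (\<phi> x)"
  using hermitian[of \<one> x] by (simp add: adj_closed)

text \<open>Cauchy-Schwarz with the arithmetic mean in place of the geometric one. It is positivity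
  at \<open>x \<oplus> c \<odot> y\<close>, the phase \<open>c\<close> being chosen to turn the
  mixed term into minus its modulus.\<close>

lemma twice_norm_le:
  assumes "x \<in> carrier \<A>" "y \<in> carrier \<A>"
  shows "2 * cmod (\<phi> (cstar_adj \<A> x \<otimes> y)) \<le>
    Re (\<phi> (cstar_adj \<A> x \<otimes> x)) + Re (\<phi> (cstar_adj \<A> y \<otimes> y))"
proof (cases "\<phi> (cstar_adj \<A> x \<otimes> y) = 0")
  case True
  then show ?thesis
    using fun_square assms by (simp add: complex_nonneg_Reals_iff)
next
  case False
  define p where "p = \<phi> (cstar_adj \<A> x \<otimes> y)"
  define c where "c = - cnj p / cmod p"
  have p0: "p \<noteq> 0" using False p_def by simp
  have cp: "c * p = - cmod p"
    using p0 by (simp add: c_def complex_norm_square[symmetric] mult.commute power2_eq_square field_simps)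
  have cc: "cnj c * c = 1"
    using p0 by (simp add: c_def complex_norm_square[symmetric] power2_eq_square field_simps)
  have "0 \<le> Re (\<phi> (cstar_adj \<A> (x \<oplus> c \<odot> y) \<otimes> (x \<oplus> c \<odot> y)))"
    using fun_square[of "x \<oplus> c \<odot> y"] assms by (simp add: complex_nonneg_Reals_iff)
  also have "\<phi> (cstar_adj \<A> (x \<oplus> c \<odot> y) \<otimes> (x \<oplus> c \<odot> y)) =
     \<phi> (cstar_adj \<A> x \<otimes> x) + c * p + cnj (c * p) + \<phi> (cstar_adj \<A> y \<otimes> y)"
    using assms cc by (simp add: sesquilinear_expand hermitian[OF assms] p_def)
  finally show ?thesis unfolding cp by (simp add: p_def)
qed

text \<open>By commutativity, the square of \<open>z\<close> times the square of \<open>x\<close> is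
  the square of \<open>z \<otimes> x\<close>.\<close>

lemma positive_compress:
  assumes z: "z \<in> carrier \<A>"
  shows "positive_functional \<A> (\<lambda>x. \<phi> (cstar_adj \<A> z \<otimes> z \<otimes> x))"
proof -
  have "\<phi> (cstar_adj \<A> z \<otimes> z \<otimes> (cstar_adj \<A> x \<otimes> x)) \<in> \<real>\<^sub>\<ge>\<^sub>0" if x: "x \<in> carrier \<A>" for x
  proof -
    have "cstar_adj \<A> z \<otimes> z \<otimes> (cstar_adj \<A> x \<otimes> x) = cstar_adj \<A> (z \<otimes> x) \<otimes> (z \<otimes> x)"
      using z x adj_closed[OF z] adj_closed[OF x] by (simp add: adj_mult m_ac)
    then show ?thesis using fun_square[of "z \<otimes> x"] z x by simp
  qed
  then show ?thesis using z adj_closed[OF z]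
    by (simp add: positive_functional_def r_distr mult_smult_right fun_add fun_smult)
qed

text \<open>The square of \<open>\<one> \<oplus> c \<odot> a\<close> has the nonnegative value
  \<open>\<phi> \<one> + 2 * c * \<phi> a + \<phi> (a \<otimes> a)\<close>. Its last term is at most
  \<open>\<phi> \<one>\<close>, which leaves twice the claimed quantity; self-adjointness makes
  \<open>\<phi> a\<close> real.\<close>

lemma contractive_bound:
  assumes a: "contractive \<A> a" and sa: "cstar_adj \<A> a = a" and c: "c = 1 \<or> c = (-1::real)"
  shows "\<phi> \<one> + c * \<phi> a \<in> \<real>\<^sub>\<ge>\<^sub>0"
proof -
  have ac: "a \<in> carrier \<A>" using a by (simp add: contractive_def)
  have le: "Re (\<phi> (a \<otimes> a)) \<le> Re (\<phi> \<one>)" using a sa positive by (auto simp: contractive_def)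
  have im1: "Im (\<phi> \<one>) = 0" using fun_square[of \<one>] by (simp add: complex_nonneg_Reals_iff)
  have ima: "Im (\<phi> a) = 0" using fun_adj[OF ac] sa by (simp add: complex_eq_iff)
  have "0 \<le> Re (\<phi> (cstar_adj \<A> (\<one> \<oplus> complex_of_real c \<odot> a) \<otimes> (\<one> \<oplus> complex_of_real c \<odot> a)))"
    using fun_square[of "\<one> \<oplus> complex_of_real c \<odot> a"] ac by (simp add: complex_nonneg_Reals_iff)
  then have "0 \<le> Re (\<phi> \<one>) + 2 * c * Re (\<phi> a) + Re (\<phi> (a \<otimes> a))"
    using ac c by (auto simp: sesquilinear_expand sa)
  then show ?thesis using le im1 ima by (auto simp: complex_nonneg_Reals_iff)
qed

text \<open>Compressing \<open>\<phi>\<close> by \<open>x\<close> reduces the claim to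
  \<open>contractive_bound\<close>; here it matters that \<open>contractive\<close> speaks of every
  positive functional.\<close>

lemma positive_weight:
  assumes a: "contractive \<A> a" and sa: "cstar_adj \<A> a = a" and c: "c = 1 \<or> c = (-1::real)"
  shows "positive_functional \<A> (\<lambda>x. \<phi> x + c * \<phi> (a \<otimes> x))"
proof -
  have ac: "a \<in> carrier \<A>" using a by (simp add: contractive_def)
  have "\<phi> (cstar_adj \<A> x \<otimes> x) + c * \<phi> (a \<otimes> (cstar_adj \<A> x \<otimes> x)) \<in> \<real>\<^sub>\<ge>\<^sub>0" if x: "x \<in> carrier \<A>" for x
  proof -
    interpret \<psi>: positive_functional_on \<A> "\<lambda>y. \<phi> (cstar_adj \<A> x \<otimes> x \<otimes> y)"
      by unfold_locales (rule positive_compress[OF x])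
    show ?thesis
      using \<psi>.contractive_bound[OF a sa c] x ac adj_closed[OF x]
      by (simp add: m_comm[of "cstar_adj \<A> x \<otimes> x" a])
  qed
  then show ?thesis using ac
    by (simp add: positive_functional_def fun_add fun_smult r_distr mult_smult_right algebra_simps)
qed

lemma positive_divide:
  assumes "0 < (r::real)"
  shows "positive_functional \<A> (\<lambda>x. \<phi> x / r)"
  using assms fun_square
  by (auto simp: positive_functional_def fun_add fun_smult add_divide_distrib complex_nonneg_Reals_iff)

end

section \<open>States with small variances\<close>

locale state_on = positive_functional_on +
  assumes fun_one [simp]: "\<phi> \<one> = 1"
begin

lemma covariance_expand:
  assumes "x \<in> carrier \<A>" "y \<in> carrier \<A>"
  shows "\<phi> (cstar_adj \<A> (x \<oplus> (- \<phi> x) \<odot> \<one>) \<otimes> (y \<oplus> (- \<phi> y) \<odot> \<one>)) =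
    \<phi> (cstar_adj \<A> x \<otimes> y) - cnj (\<phi> x) * \<phi> y"
  using assms by (simp add: sesquilinear_expand fun_adj adj_closed)

definition variance :: "'a \<Rightarrow> real" where
  "variance x = Re (\<phi> (cstar_adj \<A> x \<otimes> x)) - (cmod (\<phi> x))\<^sup>2"

lemma variance_eq:
  assumes "x \<in> carrier \<A>"
  shows "variance x = Re (\<phi> (cstar_adj \<A> (x \<oplus> (- \<phi> x) \<odot> \<one>) \<otimes> (x \<oplus> (- \<phi> x) \<odot> \<one>)))"
  using assms
  by (simp only: covariance_expand)
    (simp add: variance_def cmod_power2[unfolded power2_eq_square] power2_eq_square)

lemma variance_nonneg: "x \<in> carrier \<A> \<Longrightarrow> 0 \<le> variance x"
  using fun_square[of "x \<oplus> (- \<phi> x) \<odot> \<one>"] by (simp add: variance_eq complex_nonneg_Reals_iff)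

text \<open>Small variances make a state nearly multiplicative: this is \<open>twice_norm_le\<close>
  for the centred elements.\<close>

lemma covariance_bound:
  assumes "x \<in> carrier \<A>" "y \<in> carrier \<A>"
  shows "2 * cmod (\<phi> (cstar_adj \<A> x \<otimes> y) - cnj (\<phi> x) * \<phi> y) \<le> variance x + variance y"
  using twice_norm_le[of "x \<oplus> (- \<phi> x) \<odot> \<one>" "y \<oplus> (- \<phi> y) \<odot> \<one>"] assms
  by (simp add: covariance_expand variance_eq)

text \<open>Nonnegativity of the variance bounds the squared modulus of \<open>\<phi> x\<close> by
  the value of \<open>\<phi>\<close> at the square of \<open>x\<close>.\<close>

lemma fun_null: "\<lbrakk>x \<in> carrier \<A>; \<phi> (cstar_adj \<A> x \<otimes> x) = 0\<rbrakk> \<Longrightarrow> \<phi> x = 0"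
  using variance_nonneg[of x] by (simp add: variance_def)

lemma contractive_le_one:
  assumes "contractive \<A> a"
  shows "cmod (\<phi> a) \<le> 1"
proof -
  have "Re (\<phi> (cstar_adj \<A> a \<otimes> a)) \<le> 1" and a: "a \<in> carrier \<A>"
    using assms positive by (auto simp: contractive_def)
  then have "(cmod (\<phi> a))\<^sup>2 \<le> 1" using variance_nonneg[OF a] by (simp add: variance_def)
  then show ?thesis by (simp add: abs_square_le_1)
qed

end

context abelian_cstar_algebra
begin

lemma state_onI:
  assumes "state_killing \<A> N \<phi>"
  shows "state_on \<A> \<phi>"
  using assms by unfold_locales (auto simp: state_killing_def)

text \<open>The new state is one of the normalised halves of \<open>\<phi>\<close> weighted by
  \<open>1 + a\<close> and \<open>1 - a\<close>. A mean of squares exceeds the square of the mean by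
  a variance, so the better half gains at least the contribution of \<open>b = a\<close>.\<close>

lemma spread_increase:
  assumes \<phi>: "state_killing \<A> N \<phi>" and N: "N \<subseteq> carrier \<A>"
    and B: "finite B" "\<And>b. b \<in> B \<Longrightarrow> contractive \<A> b \<and> cstar_adj \<A> b = b"
    and a: "a \<in> B"
  obtains \<psi> where "state_killing \<A> N \<psi>"
    "(\<Sum>b\<in>B. (Re (\<psi> b))\<^sup>2) \<ge> (\<Sum>b\<in>B. (Re (\<phi> b))\<^sup>2) + (state_on.variance \<A> \<phi> a)\<^sup>2"
proof -
  interpret state_on \<A> \<phi> using \<phi> by (rule state_onI)
  have ac: "a \<in> carrier \<A>" and con: "contractive \<A> a" and sa: "cstar_adj \<A> a = a"
    using B(2)[OF a] by (auto simp: contractive_def)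
  define m where "m = Re (\<phi> a)"
  have ima: "Im (\<phi> a) = 0" using fun_adj[OF ac] sa by (simp add: complex_eq_iff)
  have \<phi>a: "\<phi> a = m" using ima by (simp add: m_def complex_eq_iff)
  have var: "variance a = Re (\<phi> (a \<otimes> a)) - m\<^sup>2"
    by (simp add: variance_def sa \<phi>a)
  have aa1: "Re (\<phi> (a \<otimes> a)) \<le> 1" using con positive sa by (auto simp: contractive_def)
  have "\<bar>m\<bar> \<le> 1" using contractive_le_one[OF con] by (simp add: \<phi>a)
  then consider "\<bar>m\<bar> = 1" | "\<bar>m\<bar> < 1" by linarith
  then show ?thesis
  proof cases
    \<comment> \<open>One of the halves would have mass zero here, but
      \<open>\<phi> (a \<otimes> a)\<close> is at most 1, so the variance of \<open>a\<close>
      vanishes and \<open>\<phi>\<close> itself serves.\<close>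
    case 1
    then have "m\<^sup>2 = 1" by (metis power2_abs power_one)
    then have "variance a = 0" using var aa1 variance_nonneg[OF ac] by simp
    then show ?thesis by (intro that[of \<phi>] \<phi>) simp
  next
    case 2
    \<comment> \<open>The weighted functional has the value \<open>1 + c * m\<close> at the unit,
      whence the divisor.\<close>
    define \<psi> where "\<psi> c x = (\<phi> x + c * \<phi> (a \<otimes> x)) / complex_of_real (1 + c * m)" for c :: real and x
    have pos: "0 < 1 + c * m" if "c = 1 \<or> c = -1" for c :: real using that 2 by auto
    have nonneg: "\<phi> x + c * \<phi> (a \<otimes> x) \<in> \<real>\<^sub>\<ge>\<^sub>0"
      if "c = 1 \<or> c = -1" "x = cstar_adj \<A> y \<otimes> y" "y \<in> carrier \<A>" for c :: real and x y
      using positive_weight[OF con sa that(1)] that(2,3) unfolding positive_functional_def by blast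
    have st: "state_killing \<A> N (\<psi> c)" if c: "c = 1 \<or> c = -1" for c :: real
    proof -
      interpret w: positive_functional_on \<A> "\<lambda>x. \<phi> x + complex_of_real c * \<phi> (a \<otimes> x)"
        by unfold_locales (rule positive_weight[OF con sa c])
      have "positive_functional \<A> (\<psi> c)"
        using w.positive_divide[OF pos[OF c]] by (simp add: \<psi>_def[abs_def])
      moreover have "1 + complex_of_real c * m \<noteq> 0"
        using pos[OF c] by (metis less_irrefl of_real_1 of_real_add of_real_eq_0_iff of_real_mult)
      then have "\<psi> c \<one> = 1"
        using ac by (simp add: \<psi>_def \<phi>a)
      moreover have "\<psi> c (cstar_adj \<A> n \<otimes> n) = 0" if n: "n \<in> N" for n
      proof -
        have "\<phi> (cstar_adj \<A> n \<otimes> n) = 0" using \<phi> n by (simp add: state_killing_def)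
        \<comment> \<open>Since \<open>\<phi>\<close> vanishes at the square of \<open>n\<close>,
          positivity for both signs of \<open>c\<close> puts this value and its negative among the
          nonnegative reals.\<close>
        moreover have "\<phi> (a \<otimes> (cstar_adj \<A> n \<otimes> n)) = 0"
          using nonneg[of 1 "cstar_adj \<A> n \<otimes> n" n] nonneg[of "-1" "cstar_adj \<A> n \<otimes> n" n] n N calculation
          by (auto simp: complex_nonneg_Reals_iff complex_eq_iff)
        ultimately show ?thesis by (simp add: \<psi>_def)
      qed
      ultimately show ?thesis by (simp add: state_killing_def)
    qed
    define F where "F \<psi> = (\<Sum>b\<in>B. (Re (\<psi> b))\<^sup>2)" for \<psi> :: "'c \<Rightarrow> complex"
    define \<beta> where "\<beta> b = Re (\<phi> b)" for b
    define \<gamma> where "\<gamma> b = Re (\<phi> (a \<otimes> b))" for b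
    have Re\<psi>: "Re (\<psi> c b) = (\<beta> b + c * \<gamma> b) / (1 + c * m)" for c b
      unfolding \<psi>_def \<beta>_def \<gamma>_def by (subst Re_divide_of_real) simp
    have m2: "0 < 1 - m\<^sup>2" "1 - m\<^sup>2 \<le> 1" using 2 by (auto simp: abs_square_less_1)
    \<comment> \<open>At \<open>b = a\<close> the difference
      \<open>\<gamma> b - m * \<beta> b\<close> is exactly the variance of \<open>a\<close>.\<close>
    have "F \<phi> + (variance a)\<^sup>2 = F \<phi> + (\<gamma> a - m * \<beta> a)\<^sup>2"
      by (simp add: var \<beta>_def \<gamma>_def m_def power2_eq_square)
    also have "\<dots> \<le> F \<phi> + (\<Sum>b\<in>B. (\<gamma> b - m * \<beta> b)\<^sup>2)"
      using member_le_sum[OF a, of "\<lambda>b. (\<gamma> b - m * \<beta> b)\<^sup>2"] B(1) by simp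
    also have "\<dots> = (\<Sum>b\<in>B. (\<beta> b)\<^sup>2 + (\<gamma> b - m * \<beta> b)\<^sup>2)"
      by (simp add: F_def \<beta>_def sum.distrib)
    \<comment> \<open>The divisor lies between 0 and 1, so no summand decreases; this brings in the
      identity for the two halves.\<close>
    also have "\<dots> \<le> (\<Sum>b\<in>B. (\<beta> b)\<^sup>2 + (\<gamma> b - m * \<beta> b)\<^sup>2 / (1 - m\<^sup>2))"
      using m2 by (intro sum_mono) (simp add: pos_le_divide_eq mult_left_le)
    also have "\<dots> = (1 + m) / 2 * F (\<psi> 1) + (1 - m) / 2 * F (\<psi> (-1))"
      unfolding F_def sum_distrib_left sum.distrib[symmetric]
      by (intro sum.cong refl) (simp add: Re\<psi> split_squares_identity[OF 2, symmetric])
    also have "\<dots> \<le> (1 + m) / 2 * max (F (\<psi> 1)) (F (\<psi> (-1))) + (1 - m) / 2 * max (F (\<psi> 1)) (F (\<psi> (-1)))"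
      using 2 by (intro add_mono mult_left_mono) auto
    also have "\<dots> = max (F (\<psi> 1)) (F (\<psi> (-1)))" by (simp add: field_simps)
    finally have "F (\<psi> 1) \<ge> F \<phi> + (variance a)\<^sup>2 \<or> F (\<psi> (-1)) \<ge> F \<phi> + (variance a)\<^sup>2"
      by linarith
    then show ?thesis
      using that[of "\<psi> 1"] that[of "\<psi> (-1)"] st[of 1] st[of "-1"] by (auto simp: F_def)
  qed
qed

text \<open>The sum of squares \<open>F\<close> is at most \<open>card B\<close> on these states. A
  state whose \<open>F\<close> is within \<open>\<delta>\<^sup>2\<close> of the supremum cannot gain
  more than that, so \<open>spread_increase\<close> bounds its variances.\<close>

lemma small_variance_selfadjoint:
  assumes \<tau>: "state_killing \<A> N \<tau>" and N: "N \<subseteq> carrier \<A>"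
    and B: "finite B" "\<And>b. b \<in> B \<Longrightarrow> contractive \<A> b \<and> cstar_adj \<A> b = b"
    and \<delta>: "0 < \<delta>"
  obtains \<phi> where "state_killing \<A> N \<phi>" "\<And>b. b \<in> B \<Longrightarrow> state_on.variance \<A> \<phi> b \<le> \<delta>"
proof -
  define F where "F \<psi> = (\<Sum>b\<in>B. (Re (\<psi> b))\<^sup>2)" for \<psi> :: "'c \<Rightarrow> complex"
  define R where "R = F ` {\<phi>. state_killing \<A> N \<phi>}"
  have "F \<phi> \<le> card B" if "state_killing \<A> N \<phi>" for \<phi>
  proof -
    interpret state_on \<A> \<phi> using that by (rule state_onI)
    have "(Re (\<phi> b))\<^sup>2 \<le> 1" if "b \<in> B" for b
      using contractive_le_one[of b] B(2)[OF that] abs_Re_le_cmod[of "\<phi> b"]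
      by (auto simp: abs_square_le_1)
    then show ?thesis using sum_bounded_above[of B "\<lambda>b. (Re (\<phi> b))\<^sup>2" 1] by (simp add: F_def)
  qed
  then have bdd: "bdd_above R" by (auto simp: R_def bdd_above_def)
  have "R \<noteq> {}" using \<tau> by (auto simp: R_def)
  moreover have "Sup R - \<delta>\<^sup>2 < Sup R" using \<delta> by simp
  ultimately obtain r where "r \<in> R" "Sup R - \<delta>\<^sup>2 < r"
    using less_cSupE by blast
  then obtain \<phi> where \<phi>: "state_killing \<A> N \<phi>" "Sup R - \<delta>\<^sup>2 < F \<phi>"
    by (auto simp: R_def)
  have "state_on.variance \<A> \<phi> b \<le> \<delta>" if b: "b \<in> B" for b
  proof -
    obtain \<psi> where "state_killing \<A> N \<psi>" "F \<psi> \<ge> F \<phi> + (state_on.variance \<A> \<phi> b)\<^sup>2"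
      using spread_increase[OF \<phi>(1) N B b] unfolding F_def by blast
    moreover from this have "F \<psi> \<le> Sup R" using bdd by (auto simp: R_def intro: cSup_upper)
    ultimately have "(state_on.variance \<A> \<phi> b)\<^sup>2 \<le> \<delta>\<^sup>2" using \<phi>(2) by linarith
    then show ?thesis using \<delta> by (simp add: power2_le_iff_abs_le)
  qed
  then show ?thesis using that \<phi>(1) by blast
qed

end

section \<open>Convergent subsequences of finite families\<close>

text \<open>Indices are treated one at a time: a monotone subsequence of the current one converges
  at the new index and keeps the limits at the old ones.\<close>

lemma bounded_real_family_convergent_subsequence:
  fixes t :: "nat \<Rightarrow> 'i \<Rightarrow> real"
  assumes "finite I" "\<And>i n. i \<in> I \<Longrightarrow> \<bar>t n i\<bar> \<le> K"
  shows "\<exists>r l. strict_mono (r :: nat \<Rightarrow> nat) \<and> (\<forall>i\<in>I. (\<lambda>n. t (r n) i) \<longlonglongrightarrow> l i)"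
  using assms
proof (induction I rule: finite_induct)
  case empty
  show ?case by (rule exI[of _ id]) (simp add: strict_mono_def)
next
  case (insert j I)
  then obtain r l where r: "strict_mono (r :: nat \<Rightarrow> nat)" "\<forall>i\<in>I. (\<lambda>n. t (r n) i) \<longlonglongrightarrow> l i"
    by auto
  obtain r' :: "nat \<Rightarrow> nat" where r': "strict_mono r'" "monoseq (\<lambda>n. t (r (r' n)) j)"
    using seq_monosub[of "\<lambda>n. t (r n) j"] by auto
  have "Bseq (\<lambda>n. t (r (r' n)) j)"
    using insert.prems by (intro BseqI'[of _ K]) auto
  then obtain l' where l': "(\<lambda>n. t (r (r' n)) j) \<longlonglongrightarrow> l'"
    using Bseq_monoseq_convergent r'(2) by (auto simp: convergent_def)
  have "(\<lambda>n. t (r (r' n)) i) \<longlonglongrightarrow> l i" if "i \<in> I" for i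
    using LIMSEQ_subseq_LIMSEQ[OF bspec[OF r(2) that] r'(1)] by (simp add: o_def)
  then have "strict_mono (r \<circ> r') \<and> (\<forall>i\<in>insert j I. (\<lambda>n. t ((r \<circ> r') n) i) \<longlonglongrightarrow> (l(j := l')) i)"
    using r r' l' insert.hyps by (auto simp: strict_mono_def)
  then show ?case by blast
qed

lemma bounded_family_convergent_subsequence:
  fixes t :: "nat \<Rightarrow> 'i \<Rightarrow> complex"
  assumes "finite I" "\<And>i n. i \<in> I \<Longrightarrow> cmod (t n i) \<le> K"
  shows "\<exists>r l. strict_mono (r :: nat \<Rightarrow> nat) \<and> (\<forall>i\<in>I. (\<lambda>n. t (r n) i) \<longlonglongrightarrow> l i)"
proof -
  \<comment> \<open>The Boolean selects the real or the imaginary part, so that one subsequence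
    handles both.\<close>
  define s where "s n = (\<lambda>(i, b). if b then Re (t n i) else Im (t n i))" for n
  have "\<bar>s n p\<bar> \<le> K" if "p \<in> I \<times> UNIV" for n p
    using assms(2)[of "fst p" n] abs_Re_le_cmod[of "t n (fst p)"] abs_Im_le_cmod[of "t n (fst p)"] that
    by (auto simp: s_def split: prod.splits)
  then obtain r l where r: "strict_mono (r :: nat \<Rightarrow> nat)"
    and l: "\<forall>p\<in>I \<times> UNIV. (\<lambda>n. s (r n) p) \<longlonglongrightarrow> l p"
    using bounded_real_family_convergent_subsequence[of "I \<times> UNIV" s K] assms(1) by auto
  have "(\<lambda>n. t (r n) i) \<longlonglongrightarrow> Complex (l (i, True)) (l (i, False))" if "i \<in> I" for i
    using bspec[OF l, of "(i, True)"] bspec[OF l, of "(i, False)"] that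
    by (auto simp: tendsto_complex_iff s_def)
  then show ?thesis using r by (intro exI[of _ r] exI[of _ "\<lambda>i. Complex (l (i, True)) (l (i, False))"]) auto
qed

section \<open>Real and imaginary parts, and approximate characters\<close>

context abelian_cstar_algebra
begin

text \<open>The values \<open>c = 1\<close> and \<open>c = -\<i>\<close> give the real and the
  imaginary part of \<open>h\<close>.\<close>

definition real_part :: "complex \<Rightarrow> 'c \<Rightarrow> 'c" where
  "real_part c h = (1/2) \<odot> (c \<odot> h \<oplus> cnj c \<odot> cstar_adj \<A> h)"

lemma real_part_closed [simp]: "h \<in> carrier \<A> \<Longrightarrow> real_part c h \<in> carrier \<A>"
  by (simp add: real_part_def adj_closed)

lemma adj_real_part: "h \<in> carrier \<A> \<Longrightarrow> cstar_adj \<A> (real_part c h) = real_part c h"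
  by (simp add: real_part_def adj_closed adj_add adj_smult adj_adj a_comm)

end

context positive_functional_on
begin

lemma fun_real_part: "h \<in> carrier \<A> \<Longrightarrow> \<phi> (real_part c h) = Re (c * \<phi> h)"
  by (simp add: real_part_def adj_closed fun_add fun_smult fun_adj complex_eq_iff)

lemma fun_real_part_square:
  assumes "h \<in> carrier \<A>"
  shows "\<phi> (real_part c h \<otimes> real_part c h) =
    (c\<^sup>2 * \<phi> (h \<otimes> h) + 2 * c * cnj c * \<phi> (cstar_adj \<A> h \<otimes> h) +
     (cnj c)\<^sup>2 * \<phi> (cstar_adj \<A> h \<otimes> cstar_adj \<A> h)) / 4"
  using assms
  by (simp add: real_part_def adj_closed l_distr r_distr mult_smult_left mult_smult_right
      fun_add fun_smult m_comm[of h "cstar_adj \<A> h"])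
    (simp add: power2_eq_square field_simps)

text \<open>The coefficients of \<open>\<phi> (h \<otimes> h)\<close> for the two values of
  \<open>c\<close> have opposite signs and cancel, likewise for the adjoints; the mixed terms
  contribute one half each.\<close>

lemma real_parts_square:
  assumes "h \<in> carrier \<A>"
  shows "\<phi> (real_part 1 h \<otimes> real_part 1 h) + \<phi> (real_part (-\<i>) h \<otimes> real_part (-\<i>) h) =
    \<phi> (cstar_adj \<A> h \<otimes> h)"
  using assms by (simp add: fun_real_part_square power2_eq_square[of "\<i>"] field_simps)

lemma real_part_square_nonneg:
  "h \<in> carrier \<A> \<Longrightarrow> 0 \<le> Re (\<phi> (real_part c h \<otimes> real_part c h))"
  using fun_square[of "real_part c h"] by (simp add: adj_real_part complex_nonneg_Reals_iff)

end

lemma (in state_on) variance_real_parts: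
  assumes "h \<in> carrier \<A>"
  shows "variance h = variance (real_part 1 h) + variance (real_part (-\<i>) h)"
  using assms real_parts_square[OF assms, THEN arg_cong[of _ _ Re]]
  by (simp add: variance_def adj_real_part fun_real_part cmod_power2[of "\<phi> h"])

context abelian_cstar_algebra
begin

text \<open>By \<open>real_parts_square\<close> its square is one of two summands, both nonnegative
  under \<open>\<phi>\<close>, of the square of \<open>h\<close>.\<close>

lemma contractive_real_part:
  assumes h: "contractive \<A> h" and c: "c = 1 \<or> c = -\<i>"
  shows "contractive \<A> (real_part c h)"
proof -
  have hc: "h \<in> carrier \<A>" using h by (simp add: contractive_def)
  have "Re (\<phi> (real_part c h \<otimes> real_part c h)) \<le> Re (\<phi> \<one>)" if "positive_functional \<A> \<phi>" for \<phi>
  proof -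
    interpret positive_functional_on \<A> \<phi> by unfold_locales (rule that)
    have "Re (\<phi> (cstar_adj \<A> h \<otimes> h)) \<le> Re (\<phi> \<one>)" using h that by (auto simp: contractive_def)
    then show ?thesis
      using real_parts_square[OF hc, THEN arg_cong[of _ _ Re]] real_part_square_nonneg[OF hc, of 1]
        real_part_square_nonneg[OF hc, of "-\<i>"] c by auto
  qed
  then show ?thesis using hc by (simp add: contractive_def adj_real_part)
qed

lemma small_variance:
  assumes \<tau>: "state_killing \<A> N \<tau>" and N: "N \<subseteq> carrier \<A>"
    and H: "finite H" "\<And>h. h \<in> H \<Longrightarrow> contractive \<A> h"
    and \<delta>: "0 < \<delta>"
  shows "\<exists>\<phi>. state_killing \<A> N \<phi> \<and> (\<forall>h\<in>H. state_on.variance \<A> \<phi> h \<le> \<delta>)"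
proof -
  define B where "B = real_part 1 ` H \<union> real_part (-\<i>) ` H"
  have Hc: "h \<in> carrier \<A>" if "h \<in> H" for h using H(2)[OF that] by (simp add: contractive_def)
  have "finite B" using H by (simp add: B_def)
  moreover have "contractive \<A> b \<and> cstar_adj \<A> b = b" if "b \<in> B" for b
    using that H(2) Hc by (auto simp: B_def contractive_real_part adj_real_part)
  \<comment> \<open>The tolerance is halved because the variance of \<open>h\<close> is the sum of
    the variances of its two parts.\<close>
  ultimately obtain \<phi> where \<phi>: "state_killing \<A> N \<phi>" "\<And>b. b \<in> B \<Longrightarrow> state_on.variance \<A> \<phi> b \<le> \<delta> / 2"
    using small_variance_selfadjoint[OF \<tau> N, of B "\<delta> / 2"] \<delta> by auto
  interpret state_on \<A> \<phi> using \<phi>(1) by (rule state_onI)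
  have "variance h \<le> \<delta>" if "h \<in> H" for h
    using variance_real_parts[OF Hc[OF that]] \<phi>(2)[of "real_part 1 h"] \<phi>(2)[of "real_part (-\<i>) h"] that
    by (auto simp: B_def)
  then show ?thesis using \<phi>(1) by blast
qed

text \<open>Only the values \<open>t\<close> of the limiting character on \<open>H\<close> are
  constructed. Variances of at most \<open>1 / real (Suc n)\<close> and
  \<open>covariance_bound\<close> make the states asymptotically multiplicative on pairs from
  \<open>H\<close>.\<close>

lemma approximate_character:
  assumes \<tau>: "state_killing \<A> N \<tau>" and N: "N \<subseteq> carrier \<A>"
    and H: "finite H" "\<And>h. h \<in> H \<Longrightarrow> contractive \<A> h"
  obtains \<phi> t where "\<And>n :: nat. state_killing \<A> N (\<phi> n)"
    "\<And>x y. \<lbrakk>x \<in> H; y \<in> H\<rbrakk> \<Longrightarrow> (\<lambda>n. \<phi> n (cstar_adj \<A> x \<otimes> y)) \<longlonglongrightarrow> cnj (t x) * t y"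
proof -
  have Hc: "h \<in> carrier \<A>" if "h \<in> H" for h using H(2)[OF that] by (simp add: contractive_def)
  have "\<forall>n. \<exists>\<phi>. state_killing \<A> N \<phi> \<and> (\<forall>h\<in>H. state_on.variance \<A> \<phi> h \<le> 1 / real (Suc n))"
    by (intro allI small_variance[OF \<tau> N H]) auto
  then obtain \<phi> where \<phi>: "\<And>n. state_killing \<A> N (\<phi> n)"
    "\<And>n h. h \<in> H \<Longrightarrow> state_on.variance \<A> (\<phi> n) h \<le> 1 / real (Suc n)"
    by metis
  have "cmod (\<phi> n h) \<le> 1" if "h \<in> H" for n h
    using state_on.contractive_le_one[OF state_onI[OF \<phi>(1)] H(2)[OF that]] .
  then obtain r t where r: "strict_mono (r :: nat \<Rightarrow> nat)" and
    t: "\<And>h. h \<in> H \<Longrightarrow> (\<lambda>n. \<phi> (r n) h) \<longlonglongrightarrow> t h"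
    using bounded_family_convergent_subsequence[OF H(1), of \<phi> 1] by blast
  have "(\<lambda>n. \<phi> (r n) (cstar_adj \<A> x \<otimes> y)) \<longlonglongrightarrow> cnj (t x) * t y" if xy: "x \<in> H" "y \<in> H" for x y
  proof -
    have "cmod (\<phi> (r n) (cstar_adj \<A> x \<otimes> y) - cnj (\<phi> (r n) x) * \<phi> (r n) y) \<le> 1 / real (Suc n)" for n
    proof -
      interpret state_on \<A> "\<phi> (r n)" using \<phi>(1) by (rule state_onI)
      \<comment> \<open>A strictly increasing \<open>r\<close> has \<open>n \<le> r n\<close>, so
        the bound survives the passage to the subsequence.\<close>
      have "1 / real (Suc (r n)) \<le> 1 / real (Suc n)"
        using seq_suble[OF r, of n] by (simp add: frac_le)
      then show ?thesis
        using covariance_bound[OF Hc[OF xy(1)] Hc[OF xy(2)]] \<phi>(2)[OF xy(1), of "r n"] \<phi>(2)[OF xy(2), of "r n"]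
        by linarith
    qed
    then have "(\<lambda>n. \<phi> (r n) (cstar_adj \<A> x \<otimes> y) - cnj (\<phi> (r n) x) * \<phi> (r n) y) \<longlonglongrightarrow> 0"
      by (intro tendsto_0_le[OF LIMSEQ_inverse_real_of_nat, of _ 1])
        (auto intro!: always_eventually simp: inverse_eq_divide)
    moreover have "(\<lambda>n. cnj (\<phi> (r n) x) * \<phi> (r n) y) \<longlonglongrightarrow> cnj (t x) * t y"
      using t[OF xy(1)] t[OF xy(2)] by (intro tendsto_intros)
    ultimately show ?thesis by (auto dest: tendsto_add)
  qed
  then show ?thesis using that[of "\<lambda>n. \<phi> (r n)" t] \<phi>(1) by blast
qed

end

section \<open>From colourings to orthogonal representations\<close>

text \<open>Both directions of the equivalence work with vectors indexed by the colours; a bijection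
  between \<open>{0..<k}\<close> and \<open>A\<close> translates.\<close>

lemma orthogonal_representation_iff_family:
  assumes A: "finite A" "card A = k"
  shows "(\<exists>\<xi>. orthogonal_representation V Es k \<xi>) \<longleftrightarrow>
    (\<exists>u :: 'x \<Rightarrow> 'a \<Rightarrow> complex. (\<forall>x\<in>V. (\<Sum>a\<in>A. u x a * cnj (u x a)) = 1) \<and>
       (\<forall>x\<in>V. \<forall>y\<in>V. {x, y} \<in> Es \<longrightarrow> (\<Sum>a\<in>A. u x a * cnj (u y a)) = 0))"
    (is "?L \<longleftrightarrow> ?R")
proof -
  obtain e where e: "bij_betw e {0..<k} A"
    using ex_bij_betw_nat_finite[OF A(1)] A(2) by auto
  have sum_e: "(\<Sum>i\<in>{0..<k}. f (e i)) = (\<Sum>a\<in>A. f a)" for f :: "'a \<Rightarrow> complex"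
    using sum.reindex_bij_betw[OF e] .
  show ?thesis
  proof
    assume ?L
    then obtain \<xi> where \<xi>: "orthogonal_representation V Es k \<xi>" by blast
    define u where "u x a = \<xi> x $ (inv_into {0..<k} e a)" for x a
    have "(\<Sum>a\<in>A. u x a * cnj (u y a)) = \<xi> x \<bullet>c \<xi> y" if "x \<in> V" "y \<in> V" for x y
    proof -
      have "\<xi> x \<in> carrier_vec k" "\<xi> y \<in> carrier_vec k"
        using \<xi> that by (auto simp: orthogonal_representation_def)
      then show ?thesis
        unfolding sum_e[symmetric] using e
        by (auto simp: scalar_prod_def u_def bij_betw_inv_into_left intro!: sum.cong)
    qed
    then show ?R using \<xi> unfolding orthogonal_representation_def by (intro exI[of _ u]) auto
  next
    assume ?R
    then obtain u :: "'x \<Rightarrow> 'a \<Rightarrow> complex" where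
      u: "\<forall>x\<in>V. (\<Sum>a\<in>A. u x a * cnj (u x a)) = 1"
        "\<forall>x\<in>V. \<forall>y\<in>V. {x, y} \<in> Es \<longrightarrow> (\<Sum>a\<in>A. u x a * cnj (u y a)) = 0"
      by blast
    have "vec k (\<lambda>i. u x (e i)) \<bullet>c vec k (\<lambda>i. u y (e i)) = (\<Sum>a\<in>A. u x a * cnj (u y a))" for x y
      unfolding sum_e[symmetric] by (auto simp: scalar_prod_def intro!: sum.cong)
    then have "orthogonal_representation V Es k (\<lambda>x. vec k (\<lambda>i. u x (e i)))"
      using u by (simp add: orthogonal_representation_def)
    then show ?L by blast
  qed
qed

section \<open>Coordinates of the pairing and of the correlations\<close>

text \<open>On the relevant indices \<open>Omega A\<close> is 1 where both the row and the column
  are diagonal pairs, and 0 elsewhere.\<close>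

lemma mat_pairing_Omega:
  assumes "finite A"
  shows "mat_pairing (A \<times> A) \<rho> (Omega A) = (\<Sum>a\<in>A. \<Sum>a'\<in>A. \<rho> (a, a) (a', a'))"
proof -
  have Om: "Omega A (a, b) (c, d) = (if a = b \<and> c = d then 1 else 0)"
    if "a \<in> A" "b \<in> A" "c \<in> A" "d \<in> A" for a b c d
  proof -
    \<comment> \<open>One nested conditional per summation variable lets the sums collapse one by
      one.\<close>
    have "Omega A (a, b) (c, d) = (\<Sum>p\<in>A. \<Sum>q\<in>A. if p = a then if q = c then if a = b \<and> c = d then 1 else 0 else 0 else 0)"
      unfolding Omega_def mat_tensor_def mat_unit_def by (auto intro!: sum.cong)
    also have "\<dots> = (\<Sum>p\<in>A. if p = a then \<Sum>q\<in>A. if q = c then if a = b \<and> c = d then 1 else 0 else 0 else 0)"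
      by (intro sum.cong) auto
    finally show ?thesis using assms that by simp
  qed
  have "mat_pairing (A \<times> A) \<rho> (Omega A) =
      (\<Sum>a\<in>A. \<Sum>b\<in>A. \<Sum>c\<in>A. \<Sum>d\<in>A. \<rho> (a, b) (c, d) * Omega A (a, b) (c, d))"
    by (simp add: mat_pairing_def mat_trace_def mat_mult_def mat_transpose_def sum.cartesian_product')
  also have "\<dots> = (\<Sum>a\<in>A. \<Sum>b\<in>A. \<Sum>c\<in>A. \<Sum>d\<in>A. if d = c then if b = a then \<rho> (a, b) (c, d) else 0 else 0)"
    by (intro sum.cong refl) (auto simp: Om)
  also have "\<dots> = (\<Sum>a\<in>A. \<Sum>b\<in>A. if b = a then \<Sum>c\<in>A. \<rho> (a, b) (c, c) else 0)"
    using assms by (intro sum.cong refl) simp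
  finally show ?thesis using assms by simp
qed

lemma corr_coefficients:
  assumes "finite A"
  shows "(\<Sum>a\<in>A. \<Sum>a'\<in>A. \<Sum>b\<in>A. \<Sum>b'\<in>A.
      s a a' b b' * mat_tensor (mat_unit a a') (mat_unit b b') (p, q) (p', q')) =
    (if p \<in> A \<and> q \<in> A \<and> p' \<in> A \<and> q' \<in> A then s p p' q q' else 0)"
proof -
  have "(\<Sum>a\<in>A. \<Sum>a'\<in>A. \<Sum>b\<in>A. \<Sum>b'\<in>A.
      s a a' b b' * mat_tensor (mat_unit a a') (mat_unit b b') (p, q) (p', q')) =
    (\<Sum>a\<in>A. if a = p then (\<Sum>a'\<in>A. if a' = p' then (\<Sum>b\<in>A. if b = q then
       (\<Sum>b'\<in>A. if b' = q' then s a a' b b' else 0) else 0) else 0) else 0)"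
    unfolding mat_tensor_def mat_unit_def by (auto intro!: sum.cong sum.neutral)
  then show ?thesis using assms by auto
qed

lemma (in positive_functional_on) fun_finsum_mult:
  assumes "finite I" "finite J" "\<And>i. i \<in> I \<Longrightarrow> f i \<in> carrier \<A>" "\<And>j. j \<in> J \<Longrightarrow> g j \<in> carrier \<A>"
  shows "\<phi> (finsum \<A> f I \<otimes> finsum \<A> g J) = (\<Sum>i\<in>I. \<Sum>j\<in>J. \<phi> (f i \<otimes> g j))"
  using assms
  by (simp add: finsum_ldistr finsum_rdistr fun_finsum Pi_def finsum_closed)
    (rule sum.swap)

lemma tracial_state_positive: "tracial_state \<A> \<tau> \<Longrightarrow> positive_functional \<A> \<tau>"
  by (simp add: tracial_state_def positive_functional_def)

text \<open>The vector of \<open>x\<close> is a normalised nonzero row of the factor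
  \<open>h x\<close> of \<open>g x\<close>, evaluated by the limit values of an approximate
  character.\<close>

lemma colouring_imp_orthogonal_family:
  fixes V :: "'x set" and A :: "'a set" and U :: "'c itself"
  assumes fin: "finite V" "finite A"
    and lt: "locally_tracial U V A \<E>" and proper: "graph_proper V Es A \<E>"
  shows "\<exists>u :: 'x \<Rightarrow> 'a \<Rightarrow> complex. (\<forall>x\<in>V. (\<Sum>a\<in>A. u x a * cnj (u x a)) = 1) \<and>
       (\<forall>x\<in>V. \<forall>y\<in>V. {x, y} \<in> Es \<longrightarrow> (\<Sum>a\<in>A. u x a * cnj (u y a)) = 0)"
proof -
  from lt obtain \<A> :: "'c cstar" and \<tau> g where
    alg: "abelian_cstar_algebra \<A>" and \<tau>: "tracial_state \<A> \<tau>" and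
    pos: "\<forall>x\<in>V. cstar_mat_pos \<A> A (g x)" and
    unit: "\<forall>x\<in>V. finsum \<A> (\<lambda>a. g x a a) A = \<one>\<^bsub>\<A>\<^esub>" and
    corr: "\<forall>x\<in>V. \<forall>y\<in>V. corr_state \<E> x y = (\<lambda>i j. \<Sum>a\<in>A. \<Sum>a'\<in>A. \<Sum>b\<in>A. \<Sum>b'\<in>A.
              \<tau> (g x a a' \<otimes>\<^bsub>\<A>\<^esub> g y b' b) * mat_tensor (mat_unit a a') (mat_unit b b') i j)"
    unfolding locally_tracial_def by blast
  interpret abelian_cstar_algebra \<A> by (rule alg)
  from bchoice[OF pos[unfolded cstar_mat_pos_def]] obtain h where
    h: "\<forall>x\<in>V. (\<forall>b\<in>A. \<forall>a\<in>A. h x b a \<in> carrier \<A>) \<and>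
      (\<forall>a\<in>A. \<forall>a'\<in>A. g x a a' =
        finsum \<A> (\<lambda>b. cstar_adj \<A> (h x b a) \<otimes>\<^bsub>\<A>\<^esub> h x b a') A)" ..
  then have hc: "\<And>x b a. \<lbrakk>x \<in> V; b \<in> A; a \<in> A\<rbrakk> \<Longrightarrow> h x b a \<in> carrier \<A>" and
    gh: "\<And>x a a'. \<lbrakk>x \<in> V; a \<in> A; a' \<in> A\<rbrakk> \<Longrightarrow>
      g x a a' = finsum \<A> (\<lambda>b. cstar_adj \<A> (h x b a) \<otimes>\<^bsub>\<A>\<^esub> h x b a') A"
    by simp_all
  have gc: "g x a a' \<in> carrier \<A>" if "x \<in> V" "a \<in> A" "a' \<in> A" for x a a'
    using that hc by (auto simp: gh adj_closed intro!: finsum_closed)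
  define H where "H = (\<lambda>(x, b, a). h x b a) ` (V \<times> A \<times> A)"
  \<comment> \<open>These are the inner products, with values in the algebra, of the rows
    \<open>b\<close> of \<open>h x\<close> and \<open>c\<close> of \<open>h y\<close>.\<close>
  define \<nu> where "\<nu> x y b c = finsum \<A> (\<lambda>a. cstar_adj \<A> (h x b a) \<otimes>\<^bsub>\<A>\<^esub> h y c a) A" for x y b c
  define N where "N = {\<nu> x y b c | x y b c. x \<in> V \<and> y \<in> V \<and> {x, y} \<in> Es \<and> b \<in> A \<and> c \<in> A}"
  have \<nu>c: "\<nu> x y b c \<in> carrier \<A>" if "x \<in> V" "y \<in> V" "b \<in> A" "c \<in> A" for x y b c
    using that hc unfolding \<nu>_def by (auto simp: adj_closed intro!: finsum_closed)
  have "finite H" using fin by (simp add: H_def)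
  \<comment> \<open>The unit as a sum of squares of entries serves twice: it makes the entries
    contractive, and it keeps the rows from all vanishing in the limit.\<close>
  have unit_expand: "\<phi> \<one>\<^bsub>\<A>\<^esub> = (\<Sum>a\<in>A. \<Sum>b\<in>A. \<phi> (cstar_adj \<A> (h x b a) \<otimes>\<^bsub>\<A>\<^esub> h x b a))"
    if "x \<in> V" "positive_functional \<A> \<phi>" for x \<phi>
  proof -
    interpret positive_functional_on \<A> \<phi> by unfold_locales (rule that)
    have "\<phi> \<one>\<^bsub>\<A>\<^esub> = \<phi> (finsum \<A> (\<lambda>a. g x a a) A)"
      using bspec[OF unit that(1)] by simp
    also have "\<dots> = (\<Sum>a\<in>A. \<phi> (g x a a))"
      using that(1) gc fin by (intro fun_finsum) auto
    also have "\<dots> = (\<Sum>a\<in>A. \<Sum>b\<in>A. \<phi> (cstar_adj \<A> (h x b a) \<otimes>\<^bsub>\<A>\<^esub> h x b a))"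
      using that(1) hc fin by (intro sum.cong) (simp_all add: gh fun_finsum adj_closed)
    finally show ?thesis .
  qed
  have contr: "contractive \<A> z" if "z \<in> H" for z
  proof -
    obtain x b a where z: "z = h x b a" "x \<in> V" "b \<in> A" "a \<in> A"
      using \<open>z \<in> H\<close> by (auto simp: H_def)
    have "Re (\<phi> (cstar_adj \<A> z \<otimes>\<^bsub>\<A>\<^esub> z)) \<le> Re (\<phi> \<one>\<^bsub>\<A>\<^esub>)" if \<phi>: "positive_functional \<A> \<phi>" for \<phi>
    proof -
      interpret positive_functional_on \<A> \<phi> by unfold_locales (rule \<phi>)
      define F where "F a b = Re (\<phi> (cstar_adj \<A> (h x b a) \<otimes>\<^bsub>\<A>\<^esub> h x b a))" for a b
      have F: "0 \<le> F a b" if "a \<in> A" "b \<in> A" for a b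
        using fun_square[OF hc[OF z(2) that(2,1)]] by (simp add: F_def complex_nonneg_Reals_iff)
      have "F a b \<le> (\<Sum>b\<in>A. F a b)" using z fin F by (intro member_le_sum) auto
      also have "\<dots> \<le> (\<Sum>a\<in>A. \<Sum>b\<in>A. F a b)"
        using z fin F by (intro member_le_sum[of a A "\<lambda>a. \<Sum>b\<in>A. F a b"]) (auto intro!: sum_nonneg)
      also have "\<dots> = Re (\<phi> \<one>\<^bsub>\<A>\<^esub>)" using unit_expand[OF z(2) \<phi>] by (simp add: F_def)
      finally show ?thesis by (simp add: F_def z(1))
    qed
    then show ?thesis using hc z by (simp add: contractive_def)
  qed
  have "N \<subseteq> carrier \<A>" using \<nu>c by (auto simp: N_def)
  have "\<tau> (cstar_adj \<A> (\<nu> x y b c) \<otimes>\<^bsub>\<A>\<^esub> \<nu> x y b c) = 0"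
    if xy: "x \<in> V" "y \<in> V" "{x, y} \<in> Es" and bc: "b \<in> A" "c \<in> A" for x y b c
  proof -
    interpret positive_functional_on \<A> \<tau> by unfold_locales (rule tracial_state_positive[OF \<tau>])
    \<comment> \<open>By commutativity \<open>G\<close> is the common summand of the square of
      \<open>\<nu> x y b c\<close> under \<open>\<tau>\<close> and of the pairing with
      \<open>Omega A\<close>.\<close>
    define G where "G b c a a' = \<tau> ((cstar_adj \<A> (h x b a) \<otimes>\<^bsub>\<A>\<^esub> h x b a') \<otimes>\<^bsub>\<A>\<^esub> (cstar_adj \<A> (h y c a') \<otimes>\<^bsub>\<A>\<^esub> h y c a))" for b c a a'
    have adj\<nu>: "cstar_adj \<A> (\<nu> x y b c) = finsum \<A> (\<lambda>a. cstar_adj \<A> (h y c a) \<otimes>\<^bsub>\<A>\<^esub> h x b a) A"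
      if "b \<in> A" "c \<in> A" for b c
      unfolding \<nu>_def using that xy fin hc
      by (subst adj_finsum) (auto simp: adj_mult adj_adj adj_closed intro!: finsum_cong')
    have sq: "\<tau> (cstar_adj \<A> (\<nu> x y b c) \<otimes>\<^bsub>\<A>\<^esub> \<nu> x y b c) = (\<Sum>a\<in>A. \<Sum>a'\<in>A. G b c a a')"
      if "b \<in> A" "c \<in> A" for b c
    proof -
      have "\<tau> (cstar_adj \<A> (\<nu> x y b c) \<otimes>\<^bsub>\<A>\<^esub> \<nu> x y b c) =
        (\<Sum>a'\<in>A. \<Sum>a\<in>A. \<tau> ((cstar_adj \<A> (h y c a') \<otimes>\<^bsub>\<A>\<^esub> h x b a') \<otimes>\<^bsub>\<A>\<^esub> (cstar_adj \<A> (h x b a) \<otimes>\<^bsub>\<A>\<^esub> h y c a)))"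
        unfolding adj\<nu>[OF that] using that xy fin hc
        by (subst \<nu>_def, subst fun_finsum_mult) (auto simp: adj_closed)
      also have "\<dots> = (\<Sum>a'\<in>A. \<Sum>a\<in>A. G b c a a')"
        using that xy hc unfolding G_def
        by (intro sum.cong refl arg_cong[of _ _ \<tau>]) (simp add: adj_closed m_ac)
      finally show ?thesis by (subst sum.swap)
    qed
    \<comment> \<open>Properness annihilates \<open>\<tau>\<close> of the trace of the product of
      \<open>g x\<close> and \<open>g y\<close>. Expanding both factors and moving the sums over
      \<open>b\<close> and \<open>c\<close> outside turns it into a sum of values at squares, all
      nonnegative, so each of them is zero.\<close>
    have "0 = (\<Sum>a\<in>A. \<Sum>a'\<in>A. \<tau> (g x a a' \<otimes>\<^bsub>\<A>\<^esub> g y a' a))"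
      using proper xy corr fin
      by (simp add: graph_proper_def mat_pairing_Omega corr_coefficients)
    also have "\<dots> = (\<Sum>a\<in>A. \<Sum>a'\<in>A. \<Sum>b\<in>A. \<Sum>c\<in>A. G b c a a')"
      using xy hc fin unfolding G_def
      by (intro sum.cong refl) (simp add: gh fun_finsum_mult adj_closed)
    also have "\<dots> = (\<Sum>a\<in>A. \<Sum>b\<in>A. \<Sum>a'\<in>A. \<Sum>c\<in>A. G b c a a')"
      by (rule sum.cong[OF refl sum.swap])
    also have "\<dots> = (\<Sum>b\<in>A. \<Sum>a\<in>A. \<Sum>a'\<in>A. \<Sum>c\<in>A. G b c a a')"
      by (rule sum.swap)
    also have "\<dots> = (\<Sum>b\<in>A. \<Sum>a\<in>A. \<Sum>c\<in>A. \<Sum>a'\<in>A. G b c a a')"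
      by (rule sum.cong[OF refl sum.cong[OF refl sum.swap]])
    also have "\<dots> = (\<Sum>b\<in>A. \<Sum>c\<in>A. \<Sum>a\<in>A. \<Sum>a'\<in>A. G b c a a')"
      by (rule sum.cong[OF refl sum.swap])
    also have "\<dots> = (\<Sum>b\<in>A. \<Sum>c\<in>A. \<tau> (cstar_adj \<A> (\<nu> x y b c) \<otimes>\<^bsub>\<A>\<^esub> \<nu> x y b c))"
      by (intro sum.cong refl) (simp add: sq)
    finally have total: "(\<Sum>b\<in>A. \<Sum>c\<in>A. \<tau> (cstar_adj \<A> (\<nu> x y b c) \<otimes>\<^bsub>\<A>\<^esub> \<nu> x y b c)) = 0" by simp
    have nonneg: "Im (\<tau> (cstar_adj \<A> (\<nu> x y b c) \<otimes>\<^bsub>\<A>\<^esub> \<nu> x y b c)) = 0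
        \<and> 0 \<le> Re (\<tau> (cstar_adj \<A> (\<nu> x y b c) \<otimes>\<^bsub>\<A>\<^esub> \<nu> x y b c))" if "b \<in> A" "c \<in> A" for b c
      using fun_square[OF \<nu>c[OF xy(1,2) that]] by (simp add: complex_nonneg_Reals_iff)
    have "(\<Sum>b\<in>A. \<Sum>c\<in>A. Re (\<tau> (cstar_adj \<A> (\<nu> x y b c) \<otimes>\<^bsub>\<A>\<^esub> \<nu> x y b c))) = 0"
      using total[THEN arg_cong[of _ _ Re]] by simp
    then have "(\<Sum>c\<in>A. Re (\<tau> (cstar_adj \<A> (\<nu> x y b c) \<otimes>\<^bsub>\<A>\<^esub> \<nu> x y b c))) = 0"
      using fin bc nonneg by (subst (asm) sum_nonneg_eq_0_iff) (auto intro!: sum_nonneg)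
    then have "Re (\<tau> (cstar_adj \<A> (\<nu> x y b c) \<otimes>\<^bsub>\<A>\<^esub> \<nu> x y b c)) = 0"
      using fin bc nonneg by (subst (asm) sum_nonneg_eq_0_iff) auto
    then show ?thesis using nonneg[OF bc] by (simp add: complex_eq_iff)
  qed
  then have "state_killing \<A> N \<tau>"
    using \<tau> tracial_state_positive[OF \<tau>] by (auto simp: state_killing_def tracial_state_def N_def)
  then obtain \<phi> t where \<phi>: "\<And>n :: nat. state_killing \<A> N (\<phi> n)" and
    t: "\<And>x y. \<lbrakk>x \<in> H; y \<in> H\<rbrakk> \<Longrightarrow> (\<lambda>n. \<phi> n (cstar_adj \<A> x \<otimes>\<^bsub>\<A>\<^esub> y)) \<longlonglongrightarrow> cnj (t x) * t y"
    using approximate_character[OF _ \<open>N \<subseteq> carrier \<A>\<close> \<open>finite H\<close> contr] by metis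
  have hH: "h x b a \<in> H" if "x \<in> V" "b \<in> A" "a \<in> A" for x b a
    using that by (force simp: H_def)
  \<comment> \<open>Each \<open>\<phi> n\<close> kills the square of \<open>\<nu> x y b c\<close>,
    hence that element itself; the relation then passes to the limit.\<close>
  have orth: "(\<Sum>a\<in>A. cnj (t (h x b a)) * t (h y c a)) = 0"
    if xy: "x \<in> V" "y \<in> V" "{x, y} \<in> Es" and bc: "b \<in> A" "c \<in> A" for x y b c
  proof -
    have "(\<Sum>a\<in>A. \<phi> n (cstar_adj \<A> (h x b a) \<otimes>\<^bsub>\<A>\<^esub> h y c a)) = 0" for n
    proof -
      interpret state_on \<A> "\<phi> n" using \<phi> by (rule state_onI)
      have "\<nu> x y b c \<in> N" using xy bc by (auto simp: N_def)
      then have "\<phi> n (cstar_adj \<A> (\<nu> x y b c) \<otimes>\<^bsub>\<A>\<^esub> \<nu> x y b c) = 0"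
        using \<phi>[of n] unfolding state_killing_def by blast
      then have "\<phi> n (\<nu> x y b c) = 0"
        by (rule fun_null[OF \<nu>c[OF xy(1,2) bc]])
      then show ?thesis using xy bc hc fin by (simp add: \<nu>_def fun_finsum adj_closed)
    qed
    moreover have "(\<lambda>n. \<Sum>a\<in>A. \<phi> n (cstar_adj \<A> (h x b a) \<otimes>\<^bsub>\<A>\<^esub> h y c a)) \<longlonglongrightarrow>
        (\<Sum>a\<in>A. cnj (t (h x b a)) * t (h y c a))"
      using xy bc by (intro tendsto_sum t hH) auto
    ultimately show ?thesis by (simp add: LIMSEQ_const_iff)
  qed
  define r where "r x b = (\<Sum>a\<in>A. (cmod (t (h x b a)))\<^sup>2)" for x b
  \<comment> \<open>The squared norms of the rows add up to 1, the limit of the values at the unit,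
    so some row is nonzero.\<close>
  have "\<exists>b\<in>A. 0 < r x b" if x: "x \<in> V" for x
  proof -
    have "(\<lambda>n. \<Sum>a\<in>A. \<Sum>b\<in>A. \<phi> n (cstar_adj \<A> (h x b a) \<otimes>\<^bsub>\<A>\<^esub> h x b a)) \<longlonglongrightarrow>
        (\<Sum>a\<in>A. \<Sum>b\<in>A. cnj (t (h x b a)) * t (h x b a))"
      using x by (intro tendsto_sum t hH) auto
    moreover have "(\<Sum>a\<in>A. \<Sum>b\<in>A. \<phi> n (cstar_adj \<A> (h x b a) \<otimes>\<^bsub>\<A>\<^esub> h x b a)) = 1" for n
      using unit_expand[OF x] \<phi>[of n] by (simp add: state_killing_def)
    ultimately have "(\<Sum>a\<in>A. \<Sum>b\<in>A. cnj (t (h x b a)) * t (h x b a)) = 1"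
      by (simp add: LIMSEQ_const_iff)
    then have "(\<Sum>b\<in>A. \<Sum>a\<in>A. cnj (t (h x b a)) * t (h x b a)) = 1"
      by (subst sum.swap)
    then have "(\<Sum>b\<in>A. complex_of_real (r x b)) = 1"
      by (simp add: r_def complex_norm_square mult.commute del: of_real_power)
    then have "(\<Sum>b\<in>A. r x b) \<noteq> 0" by (metis of_real_0 of_real_sum zero_neq_one)
    then obtain b where "b \<in> A" "r x b \<noteq> 0" by (meson sum.neutral)
    moreover have "0 \<le> r x b" by (simp add: r_def sum_nonneg)
    ultimately show ?thesis by force
  qed
  then obtain \<beta> where \<beta>: "\<And>x. x \<in> V \<Longrightarrow> \<beta> x \<in> A" "\<And>x. x \<in> V \<Longrightarrow> 0 < r x (\<beta> x)"
    by metis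
  \<comment> \<open>The conjugate fits the convention that the second argument of the inner product
    is conjugated.\<close>
  define u where "u x a = cnj (t (h x (\<beta> x) a)) / sqrt (r x (\<beta> x))" for x a
  have u_sum: "(\<Sum>a\<in>A. u x a * cnj (u y a)) =
      (\<Sum>a\<in>A. cnj (t (h x (\<beta> x) a)) * t (h y (\<beta> y) a)) / (sqrt (r x (\<beta> x)) * sqrt (r y (\<beta> y)))" for x y
    by (simp add: u_def sum_divide_distrib)
  have "(\<Sum>a\<in>A. u x a * cnj (u x a)) = 1" if "x \<in> V" for x
  proof -
    have "(\<Sum>a\<in>A. cnj (t (h x (\<beta> x) a)) * t (h x (\<beta> x) a)) = complex_of_real (r x (\<beta> x))"
      by (simp add: r_def complex_norm_square mult.commute del: of_real_power)
    moreover have "complex_of_real (sqrt (r x (\<beta> x))) * sqrt (r x (\<beta> x)) = r x (\<beta> x)"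
      using \<beta>(2)[OF that] by (simp flip: of_real_mult)
    ultimately show ?thesis using \<beta>(2)[OF that] by (simp add: u_sum)
  qed
  moreover have "(\<Sum>a\<in>A. u x a * cnj (u y a)) = 0" if "x \<in> V" "y \<in> V" "{x, y} \<in> Es" for x y
    using orth[OF that \<beta>(1)[OF that(1)] \<beta>(1)[OF that(2)]] by (simp add: u_sum)
  ultimately show ?thesis by blast
qed

section \<open>From orthogonal representations to colourings\<close>

definition scalar_cstar :: "(complex \<Rightarrow> 'c) \<Rightarrow> 'c cstar" where
  "scalar_cstar \<iota> =
     \<lparr>carrier = range \<iota>, mult = (\<lambda>x y. \<iota> (inv_into UNIV \<iota> x * inv_into UNIV \<iota> y)), one = \<iota> 1, zero = \<iota> 0,
      add = (\<lambda>x y. \<iota> (inv_into UNIV \<iota> x + inv_into UNIV \<iota> y)), smult = (\<lambda>c x. \<iota> (c * inv_into UNIV \<iota> x)),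
      cstar_adj = (\<lambda>x. \<iota> (cnj (inv_into UNIV \<iota> x))), cstar_norm = (\<lambda>x. cmod (inv_into UNIV \<iota> x))\<rparr>"

lemma cring_complex_ring: "cring complex_ring"
  unfolding complex_ring_def
  by (intro cringI abelian_groupI comm_monoidI) (auto simp: algebra_simps intro: exI[of _ "- x" for x :: complex] add.left_inverse)

context
  fixes \<iota> :: "complex \<Rightarrow> 'c"
  assumes inj: "inj \<iota>"
begin

lemma scalar_cstar_simps [simp]:
  "carrier (scalar_cstar \<iota>) = range \<iota>"
  "\<iota> z \<otimes>\<^bsub>scalar_cstar \<iota>\<^esub> \<iota> w = \<iota> (z * w)"
  "\<iota> z \<oplus>\<^bsub>scalar_cstar \<iota>\<^esub> \<iota> w = \<iota> (z + w)"
  "c \<odot>\<^bsub>scalar_cstar \<iota>\<^esub> \<iota> z = \<iota> (c * z)"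
  "\<one>\<^bsub>scalar_cstar \<iota>\<^esub> = \<iota> 1"
  "\<zero>\<^bsub>scalar_cstar \<iota>\<^esub> = \<iota> 0"
  "cstar_adj (scalar_cstar \<iota>) (\<iota> z) = \<iota> (cnj z)"
  "cstar_norm (scalar_cstar \<iota>) (\<iota> z) = cmod z"
  using inj by (simp_all add: scalar_cstar_def)

lemma cring_scalar_cstar: "cring (scalar_cstar \<iota>)"
proof (intro cringI abelian_groupI comm_monoidI)
  show "\<exists>y\<in>carrier (scalar_cstar \<iota>). y \<oplus>\<^bsub>scalar_cstar \<iota>\<^esub> x = \<zero>\<^bsub>scalar_cstar \<iota>\<^esub>"
    if x: "x \<in> carrier (scalar_cstar \<iota>)" for x
  proof -
    obtain z where "x = \<iota> z" using x by auto
    then show ?thesis by (intro bexI[of _ "\<iota> (- z)"]) auto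
  qed
qed (auto simp: algebra_simps)

lemma scalar_cstar_minus [simp]: "\<iota> z \<ominus>\<^bsub>scalar_cstar \<iota>\<^esub> \<iota> w = \<iota> (z - w)"
proof -
  interpret cring "scalar_cstar \<iota>" by (rule cring_scalar_cstar)
  have "\<ominus>\<^bsub>scalar_cstar \<iota>\<^esub> \<iota> w = \<iota> (- w)"
    by (rule minus_equality) auto
  then show ?thesis by (simp add: a_minus_def)
qed

lemma abelian_cstar_algebra_scalar: "abelian_cstar_algebra (scalar_cstar \<iota>)"
proof (intro abelian_cstar_algebra.intro abelian_cstar_algebra_axioms.intro)
  show "Module.algebra complex_ring (scalar_cstar \<iota>)"
    by (intro algebraI cring_complex_ring cring_scalar_cstar) (auto simp: algebra_simps)
next
  fix s :: "nat \<Rightarrow> 'c"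
  assume s: "range s \<subseteq> carrier (scalar_cstar \<iota>)"
    and cauchy: "\<And>e. e > 0 \<Longrightarrow>
      \<exists>N. \<forall>m\<ge>N. \<forall>n\<ge>N. cstar_norm (scalar_cstar \<iota>) (s m \<ominus>\<^bsub>scalar_cstar \<iota>\<^esub> s n) < e"
  define z where "z n = inv_into UNIV \<iota> (s n)" for n
  have s_eq: "s n = \<iota> (z n)" for n
  proof -
    have "s n \<in> range \<iota>" using s scalar_cstar_simps(1) by blast
    then show ?thesis by (simp add: z_def f_inv_into_f)
  qed
  have "Cauchy z"
    using cauchy by (simp add: s_eq Cauchy_def dist_norm)
  then obtain l where "z \<longlonglongrightarrow> l" by (auto simp: Cauchy_convergent_iff convergent_def)
  then have "(\<lambda>n. cmod (z n - l)) \<longlonglongrightarrow> 0" by (simp add: LIM_zero tendsto_norm_zero)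
  then have "(\<lambda>n. cstar_norm (scalar_cstar \<iota>) (s n \<ominus>\<^bsub>scalar_cstar \<iota>\<^esub> \<iota> l)) \<longlonglongrightarrow> 0"
    by (simp add: s_eq)
  then show "\<exists>x\<in>carrier (scalar_cstar \<iota>).
      (\<lambda>n. cstar_norm (scalar_cstar \<iota>) (s n \<ominus>\<^bsub>scalar_cstar \<iota>\<^esub> x)) \<longlonglongrightarrow> 0"
    by auto
next
  fix x y assume "x \<in> carrier (scalar_cstar \<iota>)" "y \<in> carrier (scalar_cstar \<iota>)"
  then show "cstar_norm (scalar_cstar \<iota>) (x \<oplus>\<^bsub>scalar_cstar \<iota>\<^esub> y) \<le>
      cstar_norm (scalar_cstar \<iota>) x + cstar_norm (scalar_cstar \<iota>) y"
    by (auto simp: norm_triangle_ineq)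
qed (use inj in \<open>auto simp: algebra_simps norm_mult power2_eq_square inj_eq\<close>)

text \<open>Read through \<open>\<iota>\<close>, this state is the identity of the complex
  numbers.\<close>

lemma tracial_state_scalar: "tracial_state (scalar_cstar \<iota>) (inv_into UNIV \<iota>)"
  using inj by (auto simp: tracial_state_def complex_nonneg_Reals_iff mult.commute)

lemma finsum_scalar:
  assumes "finite I"
  shows "finsum (scalar_cstar \<iota>) (\<lambda>i. \<iota> (f i)) I = \<iota> (\<Sum>i\<in>I. f i)"
proof -
  interpret cring "scalar_cstar \<iota>" by (rule cring_scalar_cstar)
  show ?thesis using assms by (induction I rule: finite_induct) auto
qed

end

text \<open>The channel with \<open>e\<^sub>x e\<^sub>x\<^sup>* \<otimes> e\<^sub>y e\<^sub>y\<^sup>* \<mapsto> w w\<^sup>*\<close> for \<open>w\<close> the vector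
  \<open>cnj (u x) \<otimes> u y\<close>.\<close>

definition product_vector :: "'a set \<Rightarrow> ('x \<Rightarrow> 'a \<Rightarrow> complex) \<Rightarrow> 'x \<times> 'x \<Rightarrow> 'a \<times> 'a \<Rightarrow> complex" where
  "product_vector A u = (\<lambda>(x, y) (a, b). if a \<in> A \<and> b \<in> A then cnj (u x a) * u y b else 0)"

definition product_channel ::
    "'x set \<Rightarrow> 'a set \<Rightarrow> ('x \<Rightarrow> 'a \<Rightarrow> complex) \<Rightarrow> ('x \<times> 'x) cmat \<Rightarrow> ('a \<times> 'a) cmat" where
  "product_channel V A u S =
     (\<lambda>i j. \<Sum>p\<in>V \<times> V. S p p * (product_vector A u p i * cnj (product_vector A u p j)))"

section \<open>The product channel and its colouring\<close>

text \<open>Only diagonal entries of \<open>S\<close> enter, each as the coefficient of a positive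
  rank one operator. The quadratic form at \<open>v\<close> thus splits over \<open>k\<close> into
  the forms of the matrices \<open>T p q k k\<close> at the vectors \<open>z k\<close>.\<close>

lemma completely_positive_rank_one_sum:
  fixes w :: "'i \<Rightarrow> 'j \<Rightarrow> complex"
  assumes fin: "finite I" "finite J"
  shows "completely_positive I D J (\<lambda>S i j. \<Sum>p\<in>I. S p p * (w p i * cnj (w p j)))"
  unfolding completely_positive_def
proof (intro allI impI)
  fix n and T :: "nat \<Rightarrow> nat \<Rightarrow> 'i cmat"
  assume pos: "mat_pos ({..<n} \<times> I) (block_mat T)"
  show "mat_pos ({..<n} \<times> J) (block_mat (\<lambda>p q. \<lambda>i j. \<Sum>k\<in>I. T p q k k * (w k i * cnj (w k j))))"
    unfolding mat_pos_def
  proof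
    fix v :: "nat \<times> 'j \<Rightarrow> complex"
    \<comment> \<open>This is the inner product of the component of \<open>v\<close> at
      \<open>p\<close> with \<open>w k\<close>.\<close>
    define z where "z k p = (\<Sum>j\<in>J. cnj (w k j) * v (p, j))" for k p
    have part: "(\<Sum>p<n. \<Sum>q<n. T p q k k * z k q * cnj (z k p)) \<in> \<real>\<^sub>\<ge>\<^sub>0" if k: "k \<in> I" for k
    proof -
      \<comment> \<open>Positivity of the block matrix is tested on a vector supported at the
        coordinate \<open>k\<close>.\<close>
      have "(\<Sum>r\<in>{..<n} \<times> I. \<Sum>s\<in>{..<n} \<times> I. block_mat T r s *
          (if snd s = k then z k (fst s) else 0) * cnj (if snd r = k then z k (fst r) else 0)) \<in> \<real>\<^sub>\<ge>\<^sub>0"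
        using pos unfolding mat_pos_def by (rule allE)
      also have "(\<Sum>r\<in>{..<n} \<times> I. \<Sum>s\<in>{..<n} \<times> I. block_mat T r s *
          (if snd s = k then z k (fst s) else 0) * cnj (if snd r = k then z k (fst r) else 0)) =
        (\<Sum>p<n. \<Sum>i\<in>I. if i = k then \<Sum>q<n. \<Sum>j\<in>I. if j = k then T p q i j * z k q * cnj (z k p) else 0 else 0)"
        by (auto simp: sum.cartesian_product' block_mat_def intro!: sum.cong sum.neutral)
      also have "\<dots> = (\<Sum>p<n. \<Sum>q<n. T p q k k * z k q * cnj (z k p))"
        using fin k by simp
      finally show ?thesis .
    qed
    have expand: "(\<Sum>i\<in>J. \<Sum>j\<in>J. T p q k k * (w k i * cnj (w k j)) * v (q, j) * cnj (v (p, i))) =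
        T p q k k * z k q * cnj (z k p)" for k p q
    proof -
      have "T p q k k * z k q * cnj (z k p) = T p q k k * (cnj (z k p) * z k q)" by simp
      also have "cnj (z k p) * z k q = (\<Sum>i\<in>J. \<Sum>j\<in>J. (w k i * cnj (v (p, i))) * (cnj (w k j) * v (q, j)))"
        by (simp add: z_def sum_product)
      finally show ?thesis by (simp add: sum_distrib_left mult_ac)
    qed
    have "(\<Sum>r\<in>{..<n} \<times> J. \<Sum>s\<in>{..<n} \<times> J.
        block_mat (\<lambda>p q. \<lambda>i j. \<Sum>k\<in>I. T p q k k * (w k i * cnj (w k j))) r s * v s * cnj (v r)) =
      (\<Sum>p<n. \<Sum>i\<in>J. \<Sum>q<n. \<Sum>j\<in>J. \<Sum>k\<in>I. T p q k k * (w k i * cnj (w k j)) * v (q, j) * cnj (v (p, i)))"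
      by (simp add: sum.cartesian_product' block_mat_def sum_distrib_right)
    also have "\<dots> = (\<Sum>p<n. \<Sum>i\<in>J. \<Sum>q<n. \<Sum>k\<in>I. \<Sum>j\<in>J. T p q k k * (w k i * cnj (w k j)) * v (q, j) * cnj (v (p, i)))"
      by (rule sum.cong[OF refl sum.cong[OF refl sum.cong[OF refl sum.swap]]])
    also have "\<dots> = (\<Sum>p<n. \<Sum>i\<in>J. \<Sum>k\<in>I. \<Sum>q<n. \<Sum>j\<in>J. T p q k k * (w k i * cnj (w k j)) * v (q, j) * cnj (v (p, i)))"
      by (rule sum.cong[OF refl sum.cong[OF refl sum.swap]])
    also have "\<dots> = (\<Sum>p<n. \<Sum>k\<in>I. \<Sum>i\<in>J. \<Sum>q<n. \<Sum>j\<in>J. T p q k k * (w k i * cnj (w k j)) * v (q, j) * cnj (v (p, i)))"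
      by (rule sum.cong[OF refl sum.swap])
    also have "\<dots> = (\<Sum>k\<in>I. \<Sum>p<n. \<Sum>i\<in>J. \<Sum>q<n. \<Sum>j\<in>J. T p q k k * (w k i * cnj (w k j)) * v (q, j) * cnj (v (p, i)))"
      by (rule sum.swap)
    also have "\<dots> = (\<Sum>k\<in>I. \<Sum>p<n. \<Sum>q<n. \<Sum>i\<in>J. \<Sum>j\<in>J. T p q k k * (w k i * cnj (w k j)) * v (q, j) * cnj (v (p, i)))"
      by (rule sum.cong[OF refl sum.cong[OF refl sum.swap]])
    also have "\<dots> = (\<Sum>k\<in>I. \<Sum>p<n. \<Sum>q<n. T p q k k * z k q * cnj (z k p))"
      by (simp only: expand)
    also have "\<dots> \<in> \<real>\<^sub>\<ge>\<^sub>0"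
      using fin(1) part by (induction I rule: finite_induct) auto
    finally show "(\<Sum>r\<in>{..<n} \<times> J. \<Sum>s\<in>{..<n} \<times> J.
        block_mat (\<lambda>p q. \<lambda>i j. \<Sum>k\<in>I. T p q k k * (w k i * cnj (w k j))) r s * v s * cnj (v r)) \<in> \<real>\<^sub>\<ge>\<^sub>0" .
  qed
qed

lemma product_vector_outside: "i \<notin> A \<times> A \<Longrightarrow> product_vector A u p i = 0"
  by (auto simp: product_vector_def split: prod.splits)

lemma product_vector_norm:
  assumes "finite A" "(\<Sum>a\<in>A. u x a * cnj (u x a)) = 1" "(\<Sum>a\<in>A. u y a * cnj (u y a)) = 1"
  shows "(\<Sum>i\<in>A \<times> A. product_vector A u (x, y) i * cnj (product_vector A u (x, y) i)) = 1"
proof -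
  have "(\<Sum>i\<in>A \<times> A. product_vector A u (x, y) i * cnj (product_vector A u (x, y) i)) =
      (\<Sum>a\<in>A. \<Sum>b\<in>A. (u x a * cnj (u x a)) * (u y b * cnj (u y b)))"
    by (simp add: sum.cartesian_product' product_vector_def mult_ac)
  also have "\<dots> = 1"
    using assms by (simp add: sum_product[symmetric])
  finally show ?thesis .
qed

text \<open>Trace preservation expresses that the product vectors have length 1.\<close>

lemma quantum_channel_product:
  fixes V :: "'x set"
  assumes fin: "finite V" "finite A" and u: "\<forall>x\<in>V. (\<Sum>a\<in>A. u x a * cnj (u x a)) = 1"
  shows "quantum_channel (V \<times> V) (diag_alg (V \<times> V)) (A \<times> A) (product_channel V A u)"
  unfolding quantum_channel_def
proof (intro conjI ballI)
  show "product_channel V A u S \<in> mat_alg (A \<times> A)" for S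
    unfolding mat_alg_def product_channel_def
    by (intro CollectI allI impI sum.neutral ballI) (metis complex_cnj_zero mult_eq_0_iff product_vector_outside)
  show "mat_linear_on (diag_alg (V \<times> V)) (product_channel V A u)"
    unfolding mat_linear_on_def product_channel_def
    by (simp only: distrib_right sum.distrib sum_distrib_left mult.assoc) simp
  show "completely_positive (V \<times> V) (diag_alg (V \<times> V)) (A \<times> A) (product_channel V A u)"
    using completely_positive_rank_one_sum[of "V \<times> V" "A \<times> A" _ "product_vector A u"] fin
    by (simp add: product_channel_def[abs_def])
  fix S :: "('x \<times> 'x) cmat"
  have "mat_trace (A \<times> A) (product_channel V A u S) =
      (\<Sum>p\<in>V \<times> V. \<Sum>i\<in>A \<times> A. S p p * (product_vector A u p i * cnj (product_vector A u p i)))"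
    unfolding mat_trace_def product_channel_def by (rule sum.swap)
  also have "\<dots> = (\<Sum>p\<in>V \<times> V. S p p)"
    using u fin by (intro sum.cong refl) (auto simp: sum_distrib_left[symmetric] product_vector_norm)
  finally show "mat_trace (A \<times> A) (product_channel V A u S) = mat_trace (V \<times> V) S"
    by (simp add: mat_trace_def)
qed

lemma corr_state_product:
  assumes "finite V" "x \<in> V" "y \<in> V"
  shows "corr_state (product_channel V A u) x y =
    (\<lambda>i j. product_vector A u (x, y) i * cnj (product_vector A u (x, y) j))"
proof (intro ext)
  fix i j
  have "corr_state (product_channel V A u) x y i j =
    (\<Sum>p\<in>V \<times> V. if p = (x, y) then product_vector A u p i * cnj (product_vector A u p j) else 0)"
    unfolding corr_state_def product_channel_def
    by (intro sum.cong refl) (auto simp: mat_tensor_def mat_unit_def split: if_splits)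
  then show "corr_state (product_channel V A u) x y i j =
      product_vector A u (x, y) i * cnj (product_vector A u (x, y) j)"
    using assms by simp
qed

lemma orthogonal_family_imp_colouring:
  fixes V :: "'x set" and A :: "'a set" and \<iota> :: "complex \<Rightarrow> 'c"
  assumes fin: "finite V" "finite A" and inj: "inj \<iota>"
    and unit: "\<forall>x\<in>V. (\<Sum>a\<in>A. u x a * cnj (u x a)) = 1"
    and orth: "\<forall>x\<in>V. \<forall>y\<in>V. {x, y} \<in> Es \<longrightarrow> (\<Sum>a\<in>A. u x a * cnj (u y a)) = 0"
  shows "quantum_loc_colouring TYPE('c) V Es A (product_channel V A u)"
  unfolding quantum_loc_colouring_def
proof (intro conjI)
  show "CQNS_correlation V A (product_channel V A u)"
    unfolding CQNS_correlation_def
  proof (intro conjI ballI)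
    show "quantum_channel (V \<times> V) (diag_alg (V \<times> V)) (A \<times> A) (product_channel V A u)"
      by (rule quantum_channel_product[OF fin unit])
    have "partial_trace1 A (corr_state (product_channel V A u) x y) =
        (\<lambda>b b'. if b \<in> A \<and> b' \<in> A then u y b * cnj (u y b') else 0)" if "x \<in> V" "y \<in> V" for x y
    proof (intro ext)
      fix b b'
      \<comment> \<open>The factor traced out contributes the squared norm of \<open>u x\<close>,
        which is 1, so the dependence on \<open>x\<close> disappears.\<close>
      have "partial_trace1 A (corr_state (product_channel V A u) x y) b b' =
          (if b \<in> A \<and> b' \<in> A then (\<Sum>a\<in>A. u x a * cnj (u x a)) * (u y b * cnj (u y b')) else 0)"
        using that fin by (auto simp: partial_trace1_def corr_state_product product_vector_def
            sum_distrib_left mult_ac intro!: sum.cong sum.neutral)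
      then show "partial_trace1 A (corr_state (product_channel V A u) x y) b b' =
          (if b \<in> A \<and> b' \<in> A then u y b * cnj (u y b') else 0)"
        using unit that by simp
    qed
    then show "partial_trace1 A (corr_state (product_channel V A u) x y) =
        partial_trace1 A (corr_state (product_channel V A u) x' y)"
      if "x \<in> V" "x' \<in> V" "y \<in> V" for x x' y
      using that by simp
    have "partial_trace2 A (corr_state (product_channel V A u) x y) =
        (\<lambda>a a'. if a \<in> A \<and> a' \<in> A then cnj (u x a) * u x a' else 0)" if "x \<in> V" "y \<in> V" for x y
    proof (intro ext)
      fix a a'
      have "partial_trace2 A (corr_state (product_channel V A u) x y) a a' =
          (if a \<in> A \<and> a' \<in> A then (\<Sum>b\<in>A. u y b * cnj (u y b)) * (cnj (u x a) * u x a') else 0)"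
        using that fin by (auto simp: partial_trace2_def corr_state_product product_vector_def
            sum_distrib_left mult_ac intro!: sum.cong sum.neutral)
      then show "partial_trace2 A (corr_state (product_channel V A u) x y) a a' =
          (if a \<in> A \<and> a' \<in> A then cnj (u x a) * u x a' else 0)"
        using unit that by simp
    qed
    then show "partial_trace2 A (corr_state (product_channel V A u) x y) =
        partial_trace2 A (corr_state (product_channel V A u) x y')"
      if "x \<in> V" "y \<in> V" "y' \<in> V" for x y y'
      using that by simp
  qed
next
  \<comment> \<open>This is the projection onto the conjugate of \<open>u x\<close>. The order
    \<open>g y b' b\<close> in a locally tracial correlation transposes the second factor, which
    explains why only the first factor of \<open>product_vector\<close> is conjugated.\<close>
  define g where "g x a a' = \<iota> (cnj (u x a) * u x a')" for x a a'
  have "cstar_mat_pos (scalar_cstar \<iota>) A (g x)" if "x \<in> V" for x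
    unfolding cstar_mat_pos_def
  \<comment> \<open>A projection is its own factor: the witness is \<open>g x\<close>
    itself.\<close>
  proof (intro exI[of _ "\<lambda>b a. \<iota> (cnj (u x b) * u x a)"] conjI ballI)
    fix a a'
    have "(\<Sum>b\<in>A. cnj (cnj (u x b) * u x a) * (cnj (u x b) * u x a')) =
        (\<Sum>b\<in>A. u x b * cnj (u x b)) * (cnj (u x a) * u x a')"
      by (simp add: sum_distrib_left mult_ac)
    then show "g x a a' = finsum (scalar_cstar \<iota>) (\<lambda>b. cstar_adj (scalar_cstar \<iota>) (\<iota> (cnj (u x b) * u x a))
        \<otimes>\<^bsub>scalar_cstar \<iota>\<^esub> \<iota> (cnj (u x b) * u x a')) A"
      using unit that by (simp add: g_def finsum_scalar[OF inj fin(2)] scalar_cstar_simps[OF inj])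
  qed (simp add: scalar_cstar_simps[OF inj])
  moreover have "finsum (scalar_cstar \<iota>) (\<lambda>a. g x a a) A = \<one>\<^bsub>scalar_cstar \<iota>\<^esub>" if "x \<in> V" for x
    using unit that by (simp add: g_def finsum_scalar[OF inj fin(2)] scalar_cstar_simps[OF inj] mult.commute)
  moreover have "corr_state (product_channel V A u) x y =
      (\<lambda>i j. \<Sum>a\<in>A. \<Sum>a'\<in>A. \<Sum>b\<in>A. \<Sum>b'\<in>A. inv_into UNIV \<iota> (g x a a' \<otimes>\<^bsub>scalar_cstar \<iota>\<^esub> g y b' b) *
         mat_tensor (mat_unit a a') (mat_unit b b') i j)" if "x \<in> V" "y \<in> V" for x y
  proof (intro ext)
    fix i j :: "'a \<times> 'a"
    obtain p q p' q' where ij: "i = (p, q)" "j = (p', q')" by fastforce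
    show "corr_state (product_channel V A u) x y i j =
      (\<Sum>a\<in>A. \<Sum>a'\<in>A. \<Sum>b\<in>A. \<Sum>b'\<in>A. inv_into UNIV \<iota> (g x a a' \<otimes>\<^bsub>scalar_cstar \<iota>\<^esub> g y b' b) *
         mat_tensor (mat_unit a a') (mat_unit b b') i j)"
      unfolding ij corr_coefficients[OF fin(2)] using that fin inj
      by (simp add: corr_state_product product_vector_def g_def scalar_cstar_simps[OF inj] mult_ac)
  qed
  moreover have "g x a a' \<in> carrier (scalar_cstar \<iota>)" for x a a'
    by (simp add: g_def scalar_cstar_simps[OF inj])
  ultimately show "locally_tracial TYPE('c) V A (product_channel V A u)"
    unfolding locally_tracial_def
    using abelian_cstar_algebra_scalar[OF inj] tracial_state_scalar[OF inj] by blast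
next
  show "graph_proper V Es A (product_channel V A u)"
    unfolding graph_proper_def
  proof (intro ballI impI)
    fix x y assume xy: "x \<in> V" "y \<in> V" "{x, y} \<in> Es"
    \<comment> \<open>The double sum factors as the squared modulus of the inner product of
      \<open>u x\<close> and \<open>u y\<close>.\<close>
    have "mat_pairing (A \<times> A) (corr_state (product_channel V A u) x y) (Omega A) =
        (\<Sum>a\<in>A. \<Sum>a'\<in>A. cnj (u x a * cnj (u y a)) * (u x a' * cnj (u y a')))"
      using xy fin by (simp add: mat_pairing_Omega corr_state_product product_vector_def mult_ac)
    also have "\<dots> = 0"
      using orth xy by (simp add: sum_product[symmetric])
    finally show "mat_pairing (A \<times> A) (corr_state (product_channel V A u) x y) (Omega A) = 0" .
  qed
qed

theorem proposition10p3:
  fixes V :: "'x set" and Es :: "'x set set" and k :: nat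
  assumes finite_vertices: "finite V"
    and edges: "Es \<subseteq> nsets V 2"
    and colour_universe: "infinite (UNIV :: 'a set)"
    and algebra_universe: "\<exists>\<iota> :: complex \<Rightarrow> 'c. inj \<iota>"
  shows "(\<exists>\<xi> :: 'x \<Rightarrow> complex vec. orthogonal_representation V Es k \<xi>) \<longleftrightarrow>
         (\<exists>A :: 'a set. finite A \<and> card A = k \<and>
            (\<exists>\<E> :: ('x \<times> 'x) cmat \<Rightarrow> ('a \<times> 'a) cmat.
               quantum_loc_colouring TYPE('c) V Es A \<E>))"
proof
  assume L: "\<exists>\<xi> :: 'x \<Rightarrow> complex vec. orthogonal_representation V Es k \<xi>"
  obtain A :: "'a set" where A: "finite A" "card A = k"
    using infinite_arbitrarily_large[OF colour_universe] by blast
  obtain \<iota> :: "complex \<Rightarrow> 'c" where \<iota>: "inj \<iota>" using algebra_universe by blast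
  from L show "\<exists>A :: 'a set. finite A \<and> card A = k \<and>
      (\<exists>\<E> :: ('x \<times> 'x) cmat \<Rightarrow> ('a \<times> 'a) cmat. quantum_loc_colouring TYPE('c) V Es A \<E>)"
    unfolding orthogonal_representation_iff_family[OF A]
    using orthogonal_family_imp_colouring[OF finite_vertices A(1) \<iota>] A by blast
next
  assume "\<exists>A :: 'a set. finite A \<and> card A = k \<and>
      (\<exists>\<E> :: ('x \<times> 'x) cmat \<Rightarrow> ('a \<times> 'a) cmat. quantum_loc_colouring TYPE('c) V Es A \<E>)"
  then obtain A :: "'a set" and \<E> where A: "finite A" "card A = k"
    and "quantum_loc_colouring TYPE('c) V Es A \<E>" by blast
  then show "\<exists>\<xi> :: 'x \<Rightarrow> complex vec. orthogonal_representation V Es k \<xi>"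
    unfolding orthogonal_representation_iff_family[OF A] quantum_loc_colouring_def
    using colouring_imp_orthogonal_family[OF finite_vertices A(1)] by blast
qed

end
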